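(* Let $\Omega\subset\mathbb{R}^d$ be a bounded domain, let $A,B\subset\mathbb{N}_0^d$ be coherent sets, and let $1\le p_1,p_2<\infty$ be such that the embedding $W^{A}_{p_1}(\Omega)\hookrightarrow W^{B}_{p_2}(\Omega)$ exists. Write $s:=|A|_1$ and $t:=|B|_1$, and further assume that $s-t\ge d(1/p_1-1/p_2)$ holds. If the embedding $W^{A}_{p_1}(\Omega)\hookrightarrow W^{B}_{p_2}(\Omega)$ is 2-factorable, then we have $$s-t\ \ge\ (d/p_1-d/2)_+ + (d/2-d/p_2)_+ .$$
   Context: $(r)_+:=\max\{0,r\}$ for $r\in\mathbb{R}$. For $\alpha\in\mathbb{N}_0^d$, $|\alpha|_1:=\alpha_1+\dots+\alpha_d$. A finite non-empty set $A\subset\mathbb{N}_0^d$ is coherent if for all $\alpha\in A$ and all $\beta\in\mathbb{N}_0^d$ with $\beta\le\alpha$ (componentwise) one has $\beta\in A$; and $|A|_1:=\max\{|\alpha|_1:\alpha\in A\}$. For a bounded domain $\Omega\subset\mathbb{R}^d$, a coherent set $A$ and $p\in[1,\infty)$, the Sobolev space of generalized mixed smoothness $W^A_p(\Omega)$ consists of all measurable functions $f:\Omega\to\mathbb{R}$ (modulo equality almost everywhere) whose weak derivatives $\partial_\alpha f$ exist for all $\alpha\in A$ and for which $\|f\|_{W^A_p(\Omega)}:=\sup_{\alpha\in A}\|\partial_\alpha f\|_{L_p(\Omega)}<\infty$. "The embedding $E\hookrightarrow F$ exists" means that $E\subset F$ and the inclusion map is continuous. A bounded linear operator $T:E\to F$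 between Banach spaces is 2-factorable if there exist a Hilbert space $H$ and bounded linear operators $U:E\to H$, $V:H\to F$ with $T=VU$. *)

theory Defs
  imports "HOL-Analysis.Analysis"
begin

section \<open>Multi-indices and coherent sets\<close>

text \<open>Multi-indices in \<open>\<nat>\<^sub>0\<^sup>d\<close> are functions \<open>'n \<Rightarrow> nat\<close> with \<open>d = CARD('n)\<close>;
  the componentwise order is the library order on functions.\<close>

definition index_order :: "('n::finite \<Rightarrow> nat) \<Rightarrow> nat" where
  "index_order \<alpha> = (\<Sum>i\<in>UNIV. \<alpha> i)"

definition coherent :: "('n::finite \<Rightarrow> nat) set \<Rightarrow> bool" where
  "coherent A \<longleftrightarrow> finite A \<and> A \<noteq> {} \<and> (\<forall>\<alpha>\<in>A. \<forall>\<beta>. \<beta> \<le> \<alpha> \<longrightarrow> \<beta> \<in> A)"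

definition set_order :: "('n::finite \<Rightarrow> nat) set \<Rightarrow> nat" where
  "set_order A = Max (index_order ` A)"

definition bounded_domain :: "'a::real_normed_vector set \<Rightarrow> bool" where
  "bounded_domain \<Omega> \<longleftrightarrow> open \<Omega> \<and> connected \<Omega> \<and> \<Omega> \<noteq> {} \<and> bounded \<Omega>"


section \<open>Test functions and weak derivatives\<close>

definition partial_derivative :: "'n::finite \<Rightarrow> (real^'n \<Rightarrow> real) \<Rightarrow> real^'n \<Rightarrow> real" where
  "partial_derivative i f x = deriv (\<lambda>t. f (x + t *\<^sub>R axis i 1)) 0"

definition iterated_partial :: "'n::finite list \<Rightarrow> (real^'n \<Rightarrow> real) \<Rightarrow> real^'n \<Rightarrow> real" where
  "iterated_partial is f = foldr partial_derivative is f"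

text \<open>Differentiability of all iterated partial derivatives on the whole space is equivalent to
  all of them existing and being continuous, i.e. to \<open>f\<close> being \<open>C\<^sup>\<infinity>\<close>.\<close>

definition smooth :: "(real^'n::finite \<Rightarrow> real) \<Rightarrow> bool" where
  "smooth f \<longleftrightarrow> (\<forall>is x. iterated_partial is f differentiable (at x))"

text \<open>The index type carries no order, so some enumeration of the multi-index is chosen. It is only
  applied to smooth functions, for which the order of differentiation is irrelevant.\<close>

definition multi_derivative ::
    "('n::finite \<Rightarrow> nat) \<Rightarrow> (real^'n \<Rightarrow> real) \<Rightarrow> real^'n \<Rightarrow> real" where
  "multi_derivative \<alpha> f = iterated_partial (SOME is. \<forall>i. count_list is i = \<alpha> i) f"

definition test_functions :: "(real^'n::finite) set \<Rightarrow> (real^'n \<Rightarrow> real) set" where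
  "test_functions \<Omega> =
     {\<phi>. smooth \<phi> \<and> compact (closure {x. \<phi> x \<noteq> 0}) \<and> closure {x. \<phi> x \<noteq> 0} \<subseteq> \<Omega>}"

definition locally_integrable :: "'a::euclidean_space set \<Rightarrow> ('a \<Rightarrow> real) \<Rightarrow> bool" where
  "locally_integrable \<Omega> f \<longleftrightarrow> (\<forall>K. compact K \<and> K \<subseteq> \<Omega> \<longrightarrow> set_integrable lebesgue K f)"

definition has_weak_derivative ::
    "(real^'n::finite) set \<Rightarrow> ('n \<Rightarrow> nat) \<Rightarrow> (real^'n \<Rightarrow> real) \<Rightarrow> (real^'n \<Rightarrow> real) \<Rightarrow> bool" where
  "has_weak_derivative \<Omega> \<alpha> f g \<longleftrightarrow>
     locally_integrable \<Omega> f \<and> locally_integrable \<Omega> g \<and>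
     (\<forall>\<phi>\<in>test_functions \<Omega>.
        (LINT x:\<Omega>|lebesgue. f x * multi_derivative \<alpha> \<phi> x) =
        (- 1) ^ index_order \<alpha> * (LINT x:\<Omega>|lebesgue. g x * \<phi> x))"

text \<open>Weak derivatives are unique up to a null set of \<open>\<Omega>\<close>, so the choice does not affect the
  norms below.\<close>

definition weak_derivative ::
    "(real^'n::finite) set \<Rightarrow> ('n \<Rightarrow> nat) \<Rightarrow> (real^'n \<Rightarrow> real) \<Rightarrow> real^'n \<Rightarrow> real" where
  "weak_derivative \<Omega> \<alpha> f = (SOME g. has_weak_derivative \<Omega> \<alpha> f g)"

definition in_Lp :: "real \<Rightarrow> 'a::euclidean_space set \<Rightarrow> ('a \<Rightarrow> real) \<Rightarrow> bool" where
  "in_Lp p \<Omega> g \<longleftrightarrow> set_borel_measurable lebesgue \<Omega> g \<and>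
     set_integrable lebesgue \<Omega> (\<lambda>x. \<bar>g x\<bar> powr p)"

definition Lp_norm :: "real \<Rightarrow> 'a::euclidean_space set \<Rightarrow> ('a \<Rightarrow> real) \<Rightarrow> real" where
  "Lp_norm p \<Omega> g = (LINT x:\<Omega>|lebesgue. \<bar>g x\<bar> powr p) powr (1 / p)"


section \<open>Measurable functions modulo equality almost everywhere\<close>

definition ae_rel :: "('a::euclidean_space \<Rightarrow> real) \<Rightarrow> ('a \<Rightarrow> real) \<Rightarrow> bool" where
  "ae_rel f g \<longleftrightarrow> f \<in> borel_measurable lebesgue \<and> g \<in> borel_measurable lebesgue \<and>
     (AE x in lebesgue. f x = g x)"

lemma ae_rel_part_equivp: "part_equivp ae_rel"
proof (rule part_equivpI)
  show "\<exists>f. ae_rel f f"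
    by (rule exI[of _ "\<lambda>_. 0"]) (simp add: ae_rel_def)
  show "symp ae_rel"
    by (auto simp: symp_def ae_rel_def eq_commute)
  show "transp ae_rel"
    by (auto simp: transp_def ae_rel_def)
qed

quotient_type (overloaded) 'a aefun = "'a::euclidean_space \<Rightarrow> real" / partial: ae_rel
  by (rule ae_rel_part_equivp)

instantiation aefun :: (euclidean_space) real_vector
begin

lift_definition zero_aefun :: "'a aefun" is "\<lambda>_. 0"
  by (simp add: ae_rel_def)

lift_definition plus_aefun :: "'a aefun \<Rightarrow> 'a aefun \<Rightarrow> 'a aefun" is "\<lambda>f g x. f x + g x"
  by (auto simp: ae_rel_def)

lift_definition uminus_aefun :: "'a aefun \<Rightarrow> 'a aefun" is "\<lambda>f x. - f x"
  by (auto simp: ae_rel_def)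

lift_definition minus_aefun :: "'a aefun \<Rightarrow> 'a aefun \<Rightarrow> 'a aefun" is "\<lambda>f g x. f x - g x"
  by (auto simp: ae_rel_def)

lift_definition scaleR_aefun :: "real \<Rightarrow> 'a aefun \<Rightarrow> 'a aefun" is "\<lambda>c f x. c * f x"
  by (auto simp: ae_rel_def)

instance
  by standard (transfer; auto simp: ae_rel_def algebra_simps)+

end


section \<open>Sobolev spaces of generalized mixed smoothness\<close>

text \<open>A measurable function on \<open>\<Omega>\<close> modulo equality almost everywhere on \<open>\<Omega>\<close> is identified with
  the class of its extension by zero, so that all spaces over \<open>\<Omega>\<close> are linear subspaces of
  one real vector space. Neither definition depends on the representative of the class \<open>u\<close>.\<close>

definition sobolev_space ::
    "(real^'n::finite) set \<Rightarrow> ('n \<Rightarrow> nat) set \<Rightarrow> real \<Rightarrow> (real^'n) aefun set" where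
  "sobolev_space \<Omega> A p =
     {u. (AE x in lebesgue. x \<notin> \<Omega> \<longrightarrow> rep_aefun u x = 0) \<and>
         (\<forall>\<alpha>\<in>A. (\<exists>g. has_weak_derivative \<Omega> \<alpha> (rep_aefun u) g) \<and>
                in_Lp p \<Omega> (weak_derivative \<Omega> \<alpha> (rep_aefun u)))}"

definition sobolev_norm ::
    "(real^'n::finite) set \<Rightarrow> ('n \<Rightarrow> nat) set \<Rightarrow> real \<Rightarrow> (real^'n) aefun \<Rightarrow> real" where
  "sobolev_norm \<Omega> A p u = (SUP \<alpha>\<in>A. Lp_norm p \<Omega> (weak_derivative \<Omega> \<alpha> (rep_aefun u)))"


section \<open>Operators between normed spaces given by carriers\<close>

text \<open>A normed space is a linear subspace \<open>E\<close> of a real vector space together with a norm \<open>nE\<close>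
  on \<open>E\<close>.\<close>

definition embedding_exists ::
    "'a::real_vector set \<Rightarrow> ('a \<Rightarrow> real) \<Rightarrow> 'a set \<Rightarrow> ('a \<Rightarrow> real) \<Rightarrow> bool" where
  "embedding_exists E nE F nF \<longleftrightarrow> E \<subseteq> F \<and>
     (\<forall>u\<in>E. \<forall>\<epsilon>>0. \<exists>\<delta>>0. \<forall>v\<in>E. nE (v - u) < \<delta> \<longrightarrow> nF (v - u) < \<epsilon>)"

definition bounded_operator ::
    "'a::real_vector set \<Rightarrow> ('a \<Rightarrow> real) \<Rightarrow> 'b::real_vector set \<Rightarrow> ('b \<Rightarrow> real) \<Rightarrow> ('a \<Rightarrow> 'b) \<Rightarrow> bool"
  where
  "bounded_operator E nE F nF T \<longleftrightarrow>
     (\<forall>u\<in>E. T u \<in> F) \<and>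
     (\<forall>u\<in>E. \<forall>v\<in>E. T (u + v) = T u + T v) \<and>
     (\<forall>c. \<forall>u\<in>E. T (c *\<^sub>R u) = c *\<^sub>R T u) \<and>
     (\<exists>K. \<forall>u\<in>E. nF (T u) \<le> K * nE u)"

text \<open>The intermediate Hilbert space is the type \<open>'h\<close>. Existence of a Hilbert space in a hypothesis
  is expressed by leaving \<open>'h\<close> as a type variable, i.e. universally quantified in the theorem.\<close>

definition two_factorable ::
    "'h::{real_inner,complete_space} itself \<Rightarrow>
     'a::real_vector set \<Rightarrow> ('a \<Rightarrow> real) \<Rightarrow> 'b::real_vector set \<Rightarrow> ('b \<Rightarrow> real) \<Rightarrow> ('a \<Rightarrow> 'b) \<Rightarrow> bool"
  where
  "two_factorable _ E nE F nF T \<longleftrightarrow>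
     bounded_operator E nE F nF T \<and>
     (\<exists>(U :: 'a \<Rightarrow> 'h) (V :: 'h \<Rightarrow> 'b).
        bounded_operator E nE UNIV norm U \<and>
        bounded_operator UNIV norm F nF V \<and>
        (\<forall>u\<in>E. T u = V (U u)))"

end

theory Submission
  imports Defs "HOL-Computational_Algebra.Polynomial"
begin

text \<open>
  If \<open>id = V \<circ> U\<close> factors through a Hilbert space, then the embedding inherits from the
  parallelogram law an inequality of type 2 and one of cotype 2: for finitely many elements
  \<open>x k\<close> of the source space \<open>E\<close> there are signs with
  \<open>\<parallel>\<Sum> \<epsilon> k x k\<parallel>\<^sub>F\<^sup>2 \<le> C\<^sup>2 \<Sum> \<parallel>x k\<parallel>\<^sub>E\<^sup>2\<close>, and there are signs with
  \<open>\<Sum> \<parallel>x k\<parallel>\<^sub>F\<^sup>2 \<le> C\<^sup>2 \<parallel>\<Sum> \<epsilon> k x k\<parallel>\<^sub>E\<^sup>2\<close> (\<open>two_factorable_type_cotype\<close>).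

  Both are tested on \<open>m\<^sup>d\<close> translates \<open>x k\<close> of one smooth bump, rescaled to the size
  \<open>h = L / m\<close> and placed on a grid of disjoint cells in a cube inside \<open>\<Omega>\<close>. Every derivative of
  order \<open>r\<close> costs a factor \<open>h\<^sup>-\<^sup>r\<close>, and since the supports are disjoint, the signs do not
  influence \<open>L\<^sub>p\<close> norms, which only see the volume of the support. As \<open>m \<rightarrow> \<infinity>\<close>, up to
  constants (\<open>sobolev_norm_bump_sum_le\<close>, \<open>sobolev_norm_bump_sum_ge\<close>, \<open>grid_scaling\<close>)
  \<^item> a single bump has norm at most \<open>m\<close> to the power \<open>s - d/p1\<close> in the source and at least \<open>m\<close> to
    the power \<open>t - d/p2\<close> in the target,
  \<^item> a signed sum of all bumps has norm at most \<open>m\<^sup>s\<close> in the source and at least \<open>m\<^sup>t\<close> in the target.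

  Comparing exponents, boundedness of the embedding gives \<open>s \<ge> t\<close>, the type inequality gives
  \<open>s - t \<ge> d/p1 - d/2\<close> and the cotype inequality gives \<open>s - t \<ge> d/2 - d/p2\<close>. Together with the
  assumed \<open>s - t \<ge> d/p1 - d/p2\<close> these are the four possible values of the sum of the two positive
  parts.

  The analytic part makes these norms accessible from the definition by weak derivatives. For
  smooth functions with compact support the classical derivatives are weak derivatives, by
  integration by parts (\<open>integral_by_parts_iterated\<close>); they are the only ones, up to null sets, by the
  fundamental lemma of the calculus of variations. The bumps are products of functions of the single
  coordinates, so that the order of differentiation visibly does not matter for them.
\<close>

section \<open>Signs in inner product spaces\<close>

text \<open>The signs are chosen one after the other. When \<open>x j\<close> is added to the partial sum \<open>S\<close>, the squared
  norm becomes \<open>\<parallel>S\<parallel>\<^sup>2 + \<parallel>x j\<parallel>\<^sup>2 \<plusminus> 2 \<langle>x j, S\<rangle>\<close>, and the sign makes the mixed term nonpositive. Such a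
  greedy choice is enough here and replaces the usual average over all signs.\<close>

lemma ex_signs_norm_le:
  fixes x :: "'k \<Rightarrow> 'h::real_inner"
  assumes "finite K"
  shows "\<exists>\<epsilon>. (\<forall>k. \<epsilon> k \<in> {-1, 1}) \<and> (norm (\<Sum>k\<in>K. \<epsilon> k *\<^sub>R x k))\<^sup>2 \<le> (\<Sum>k\<in>K. (norm (x k))\<^sup>2)"
  using assms
proof induction
  case empty
  show ?case by (intro exI[of _ "\<lambda>_. 1"]) simp
next
  case (insert j K)
  then obtain \<epsilon> where e: "\<forall>k. \<epsilon> k \<in> {-1, 1::real}"
    and le: "(norm (\<Sum>k\<in>K. \<epsilon> k *\<^sub>R x k))\<^sup>2 \<le> (\<Sum>k\<in>K. (norm (x k))\<^sup>2)" by blast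
  define \<sigma> :: real where "\<sigma> = (if inner (x j) (\<Sum>k\<in>K. \<epsilon> k *\<^sub>R x k) \<le> 0 then 1 else -1)"
  have "(\<Sum>k\<in>K. (\<epsilon>(j := \<sigma>)) k *\<^sub>R x k) = (\<Sum>k\<in>K. \<epsilon> k *\<^sub>R x k)"
    using insert by (intro sum.cong) auto
  then have "(norm (\<Sum>k\<in>insert j K. (\<epsilon>(j := \<sigma>)) k *\<^sub>R x k))\<^sup>2 \<le> (norm (x j))\<^sup>2 + (norm (\<Sum>k\<in>K. \<epsilon> k *\<^sub>R x k))\<^sup>2"
    using insert by (simp add: \<sigma>_def power2_norm_eq_inner inner_add_left inner_add_right
       inner_diff_left inner_diff_right inner_commute)
  with le insert have "(norm (\<Sum>k\<in>insert j K. (\<epsilon>(j := \<sigma>)) k *\<^sub>R x k))\<^sup>2 \<le> (\<Sum>k\<in>insert j K. (norm (x k))\<^sup>2)"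
    by simp
  with e show ?case by (intro exI[of _ "\<epsilon>(j := \<sigma>)"]) (auto simp: \<sigma>_def)
qed

lemma ex_signs_norm_ge:
  fixes x :: "'k \<Rightarrow> 'h::real_inner"
  assumes "finite K"
  shows "\<exists>\<epsilon>. (\<forall>k. \<epsilon> k \<in> {-1, 1}) \<and> (\<Sum>k\<in>K. (norm (x k))\<^sup>2) \<le> (norm (\<Sum>k\<in>K. \<epsilon> k *\<^sub>R x k))\<^sup>2"
  using assms
proof induction
  case empty
  show ?case by (intro exI[of _ "\<lambda>_. 1"]) simp
next
  case (insert j K)
  then obtain \<epsilon> where e: "\<forall>k. \<epsilon> k \<in> {-1, 1::real}"
    and le: "(\<Sum>k\<in>K. (norm (x k))\<^sup>2) \<le> (norm (\<Sum>k\<in>K. \<epsilon> k *\<^sub>R x k))\<^sup>2" by blast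
  define \<sigma> :: real where "\<sigma> = (if inner (x j) (\<Sum>k\<in>K. \<epsilon> k *\<^sub>R x k) \<ge> 0 then 1 else -1)"
  have "(\<Sum>k\<in>K. (\<epsilon>(j := \<sigma>)) k *\<^sub>R x k) = (\<Sum>k\<in>K. \<epsilon> k *\<^sub>R x k)"
    using insert by (intro sum.cong) auto
  then have "(norm (x j))\<^sup>2 + (norm (\<Sum>k\<in>K. \<epsilon> k *\<^sub>R x k))\<^sup>2 \<le> (norm (\<Sum>k\<in>insert j K. (\<epsilon>(j := \<sigma>)) k *\<^sub>R x k))\<^sup>2"
    using insert by (simp add: \<sigma>_def power2_norm_eq_inner inner_add_left inner_add_right
       inner_diff_left inner_diff_right inner_commute)
  with le insert have "(\<Sum>k\<in>insert j K. (norm (x k))\<^sup>2) \<le> (norm (\<Sum>k\<in>insert j K. (\<epsilon>(j := \<sigma>)) k *\<^sub>R x k))\<^sup>2"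
    by simp
  with e show ?case by (intro exI[of _ "\<epsilon>(j := \<sigma>)"]) (auto simp: \<sigma>_def)
qed

section \<open>Smooth bumps on the line\<close>

definition smooth_real :: "(real \<Rightarrow> real) \<Rightarrow> bool" where
  "smooth_real f \<longleftrightarrow> (\<forall>j x. (deriv ^^ j) f differentiable at x)"

text \<open>A coinduction principle: smoothness is membership in some set of functions that is closed under
  differentiation. It avoids explicit formulas for the higher derivatives.\<close>

lemma smooth_real_coinduct:
  assumes "f \<in> S" and S: "\<And>f. f \<in> S \<Longrightarrow> \<exists>f'\<in>S. \<forall>x. (f has_real_derivative f' x) (at x)"
  shows "smooth_real f"
proof -
  have deriv_S: "deriv f \<in> S" if f: "f \<in> S" for f
  proof -
    obtain f' where f': "f' \<in> S" "\<forall>x. (f has_real_derivative f' x) (at x)" using S[OF f] by blast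
    then have "deriv f = f'" by (auto intro!: ext DERIV_imp_deriv)
    with f' show ?thesis by simp
  qed
  have "(deriv ^^ j) f \<in> S" for j by (induction j) (auto simp: assms deriv_S)
  then show ?thesis unfolding smooth_real_def using S real_differentiable_def by blast
qed

lemma smooth_real_DERIV:
  "smooth_real f \<Longrightarrow> ((deriv ^^ j) f has_real_derivative (deriv ^^ Suc j) f x) (at x)"
  unfolding smooth_real_def by (simp add: DERIV_deriv_iff_real_differentiable)

lemma smooth_real_continuous: "smooth_real f \<Longrightarrow> continuous_on UNIV ((deriv ^^ j) f)"
  unfolding smooth_real_def
  by (simp add: continuous_on_eq_continuous_at differentiable_imp_continuous_within)

lemma funpow_deriv_affine:
  assumes "smooth_real f"
  shows "(deriv ^^ j) (\<lambda>x. f (c * x + e)) = (\<lambda>x. c ^ j * (deriv ^^ j) f (c * x + e))"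
proof (induction j)
  case (Suc j)
  have "((\<lambda>x. c ^ j * (deriv ^^ j) f (c * x + e)) has_real_derivative
      c ^ Suc j * (deriv ^^ Suc j) f (c * x + e)) (at x)" for x
    by (rule derivative_eq_intros DERIV_chain2[OF smooth_real_DERIV[OF assms]] refl)+ simp
  then show ?case by (auto simp: Suc intro!: ext DERIV_imp_deriv)
qed simp

lemma smooth_real_affine: "smooth_real f \<Longrightarrow> smooth_real (\<lambda>x. f (c * x + e))"
proof (rule smooth_real_coinduct[of _ "{\<lambda>x. k * (deriv ^^ j) f (c * x + e) | k j. True}"])
  fix g assume f: "smooth_real f" and "g \<in> {\<lambda>x. k * (deriv ^^ j) f (c * x + e) | k j. True}"
  then obtain k j where g: "g = (\<lambda>x. k * (deriv ^^ j) f (c * x + e))" by auto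
  have "(g has_real_derivative (k * c) * (deriv ^^ Suc j) f (c * x + e)) (at x)" for x unfolding g
    by (rule derivative_eq_intros DERIV_chain2[OF smooth_real_DERIV[OF f]] refl)+ simp
  then show "\<exists>f'\<in>{\<lambda>x. k * (deriv ^^ j) f (c * x + e) | k j. True}. \<forall>x. (g has_real_derivative f' x) (at x)"
    by (intro bexI[of _ "\<lambda>x. (k * c) * (deriv ^^ Suc j) f (c * x + e)"]) blast+
qed (rule CollectI, rule exI[of _ 1], rule exI[of _ 0], simp)

text \<open>The function \<open>exp (- 1 / x)\<close>, extended by zero to the left, together with its multiples by
  polynomials in \<open>1 / x\<close>. This is a family that is closed under differentiation.\<close>

definition flat :: "real poly \<Rightarrow> real \<Rightarrow> real" where
  "flat q x = (if x > 0 then poly q (1 / x) * exp (- (1 / x)) else 0)"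

lemma poly_times_exp_minus_tendsto_0: "((\<lambda>t. poly q t * exp (- t)) \<longlongrightarrow> (0::real)) at_top"
proof -
  have "((\<lambda>t. \<Sum>i\<le>degree q. coeff q i * (t ^ i / exp t)) \<longlongrightarrow> (\<Sum>i\<le>degree q. coeff q i * 0)) at_top"
    by (intro tendsto_intros tendsto_power_div_exp_0)
  then show ?thesis
    by (simp add: poly_altdef sum_distrib_right exp_minus divide_inverse mult.assoc)
qed

text \<open>At \<open>0\<close> the difference quotient from the right is \<open>t q(t) exp (- t)\<close> with \<open>t = 1 / y \<rightarrow> \<infinity>\<close>, and the
  exponential beats the polynomial.\<close>

lemma flat_has_derivative:
  "(flat q has_real_derivative flat ([:0, 0, 1:] * (q - pderiv q)) x) (at x)"
proof -
  consider "x > 0" | "x < 0" | "x = 0" by linarith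
  then show ?thesis
  proof cases
    case 1
    have "((\<lambda>y. poly q (1 / y) * exp (- (1 / y))) has_real_derivative
         flat ([:0, 0, 1:] * (q - pderiv q)) x) (at x)"
      using 1 by (auto intro!: derivative_eq_intros DERIV_chain2[OF poly_DERIV]
        simp: flat_def divide_simps power2_eq_square algebra_simps)
    moreover have "eventually (\<lambda>y. y \<in> {0<..}) (nhds x)"
      using 1 by (intro eventually_nhds_in_open) auto
    then have "eventually (\<lambda>y. flat q y = poly q (1 / y) * exp (- (1 / y))) (nhds x)"
      by eventually_elim (auto simp: flat_def)
    ultimately show ?thesis by (subst DERIV_cong_ev[OF refl _ refl])
  next
    case 2
    have "eventually (\<lambda>y. y \<in> {..<0}) (nhds x)"
      using 2 by (intro eventually_nhds_in_open) auto
    then have "eventually (\<lambda>y. flat q y = 0) (nhds x)"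
      by eventually_elim (auto simp: flat_def)
    then show ?thesis using 2 by (subst DERIV_cong_ev[OF refl _ refl]) (auto simp: flat_def)
  next
    case 3
    \<comment> \<open>the factor \<open>1 / y\<close> is turned into multiplication of the polynomial by the variable\<close>
    have "((\<lambda>y. flat q y / y) \<longlongrightarrow> 0) (at_right 0)"
    proof (rule Lim_transform_eventually)
      show "((\<lambda>y. poly (pCons 0 q) (inverse y) * exp (- inverse y)) \<longlongrightarrow> 0) (at_right (0::real))"
        by (rule filterlim_compose[OF poly_times_exp_minus_tendsto_0 filterlim_inverse_at_top_right])
      show "eventually (\<lambda>y. poly (pCons 0 q) (inverse y) * exp (- inverse y) = flat q y / y) (at_right (0::real))"
        using eventually_at_right_less[of 0]
        by eventually_elim (simp add: flat_def field_simps)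
    qed
    moreover have "((\<lambda>y. flat q y / y) \<longlongrightarrow> 0) (at_left 0)"
      by (rule tendsto_eventually, subst eventually_at_filter) (auto simp: flat_def)
    ultimately have "((\<lambda>y. flat q y / y) \<longlongrightarrow> 0) (at 0)"
      by (simp add: filterlim_split_at)
    then show ?thesis using 3 by (simp add: has_field_derivative_iff flat_def)
  qed
qed

text \<open>Sums of the products from which bumps are formed; they are closed under differentiation. Factors \<open>\<plusminus>n\<close>
  produced by the chain rule are absorbed into the polynomials.\<close>

inductive_set flat_products :: "real \<Rightarrow> real \<Rightarrow> real \<Rightarrow> (real \<Rightarrow> real) set" for n a b where
  prod: "(\<lambda>x. flat p (n * (x - a)) * flat q (n * (b - x))) \<in> flat_products n a b"
| add: "f \<in> flat_products n a b \<Longrightarrow> g \<in> flat_products n a b \<Longrightarrow> (\<lambda>x. f x + g x) \<in> flat_products n a b"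

lemma flat_smult: "flat (smult c p) x = c * flat p x"
  by (simp add: flat_def)

lemma smooth_real_flat_product:
  "smooth_real (\<lambda>x. flat p (n * (x - a)) * flat q (n * (b - x)))"
proof (rule smooth_real_coinduct[of _ "flat_products n a b"])
  fix f assume "f \<in> flat_products n a b"
  then show "\<exists>f'\<in>flat_products n a b. \<forall>x. (f has_real_derivative f' x) (at x)"
  proof induction
    case (prod p q)
    let ?D = "\<lambda>p. [:0, 0, 1:] * (p - pderiv p) :: real poly"
    let ?f' = "\<lambda>x. flat (smult n (?D p)) (n * (x - a)) * flat q (n * (b - x)) +
                flat p (n * (x - a)) * flat (smult (- n) (?D q)) (n * (b - x))"
    have "((\<lambda>x. flat p (n * (x - a)) * flat q (n * (b - x))) has_real_derivative ?f' x) (at x)" for x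
      unfolding flat_smult
      by (rule derivative_eq_intros DERIV_chain2[OF flat_has_derivative] refl)+
         (simp add: algebra_simps)
    moreover have "?f' \<in> flat_products n a b" by (intro flat_products.intros)
    ultimately show ?case by (intro bexI[of _ ?f']) blast+
  next
    case (add f g)
    then obtain f' g' where "f' \<in> flat_products n a b" "g' \<in> flat_products n a b"
      "\<forall>x. (f has_real_derivative f' x) (at x)" "\<forall>x. (g has_real_derivative g' x) (at x)" by blast
    then show ?case
      by (intro bexI[of _ "\<lambda>x. f' x + g' x"]) (auto intro: flat_products.add DERIV_add)
  qed
qed (rule flat_products.prod)

text \<open>A bump on \<open>(a, b)\<close>. Large values of \<open>n\<close> steepen both flanks, so that in the limit the bump becomes
  the indicator function of \<open>(a, b)\<close>; this is what the fundamental lemma needs.\<close>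

definition bump :: "real \<Rightarrow> real \<Rightarrow> real \<Rightarrow> real \<Rightarrow> real" where
  "bump n a b x = flat 1 (n * (x - a)) * flat 1 (n * (b - x))"

lemma smooth_real_bump: "smooth_real (bump n a b)"
  using smooth_real_flat_product[of 1 n a 1 b] by (simp add: bump_def[abs_def])

lemma bump_nonneg: "0 \<le> bump n a b x" and bump_le_1: "bump n a b x \<le> 1"
  by (auto simp: bump_def flat_def intro!: mult_le_one)

lemma bump_pos_iff:
  assumes "n > 0" shows "bump n a b x > 0 \<longleftrightarrow> x \<in> {a<..<b}"
  using assms by (auto simp: bump_def flat_def zero_less_mult_iff)

lemma bump_eq_0_iff:
  assumes "n > 0" shows "bump n a b x = 0 \<longleftrightarrow> x \<notin> {a<..<b}"
  using bump_pos_iff[OF assms, of a b x] bump_nonneg[of n a b x] by linarith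

lemma flat_1_tendsto_1:
  assumes "x > 0" shows "(\<lambda>n. flat 1 (real (Suc n) * x)) \<longlonglongrightarrow> 1"
proof -
  have "(\<lambda>n. exp (- (inverse (real (Suc n)) * (1 / x)))) \<longlonglongrightarrow> exp (- (0 * (1 / x)))"
    by (intro tendsto_intros LIMSEQ_inverse_real_of_nat)
  moreover have "0 < real (Suc n) * x" for n using assms by simp
  ultimately show ?thesis by (simp add: flat_def field_simps del: of_nat_Suc)
qed

lemma bump_tendsto_indicator:
  "(\<lambda>n. bump (real (Suc n)) a b x) \<longlonglongrightarrow> indicator {a<..<b} x"
proof (cases "x \<in> {a<..<b}")
  case True
  then have "(\<lambda>n. bump (real (Suc n)) a b x) \<longlonglongrightarrow> 1 * 1"
    unfolding bump_def by (intro tendsto_mult flat_1_tendsto_1) auto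
  with True show ?thesis by simp
next
  case False
  then have "bump (real (Suc n)) a b x = 0" for n by (subst bump_eq_0_iff) auto
  with False show ?thesis by simp
qed

lemma deriv_zero_outside:
  assumes "closed S" "\<And>x. x \<notin> S \<Longrightarrow> f x = (0::real)" "x \<notin> S"
  shows "(deriv ^^ j) f x = 0"
  using \<open>x \<notin> S\<close>
proof (induction j arbitrary: x)
  case (Suc j)
  have "eventually (\<lambda>y. y \<in> - S) (nhds x)"
    using Suc.prems assms(1) by (intro eventually_nhds_in_open) auto
  then have "eventually (\<lambda>y. (deriv ^^ j) f y = 0) (nhds x)"
    by eventually_elim (simp add: Suc.IH)
  then have "((deriv ^^ j) f has_real_derivative 0) (at x)"
    by (subst DERIV_cong_ev[OF refl _ refl]) auto
  then show ?case by (simp add: DERIV_imp_deriv)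
qed (simp add: assms)

text \<open>If the derivative of order \<open>j + 1\<close> vanished identically, the derivative of order \<open>j\<close> would be
  constant, hence zero, because it vanishes off \<open>S\<close>.\<close>

lemma smooth_real_deriv_nonzero:
  assumes f: "smooth_real f" and S: "closed S" "S \<noteq> UNIV" "\<And>x. x \<notin> S \<Longrightarrow> f x = 0" and nz: "f y \<noteq> 0"
  shows "\<exists>x. (deriv ^^ j) f x \<noteq> 0"
proof (induction j)
  case (Suc j)
  show ?case
  proof (rule ccontr)
    assume *: "\<not> ?thesis"
    then have "((deriv ^^ j) f has_real_derivative 0) (at x)" for x
      using smooth_real_DERIV[OF f, of j x] by simp
    then have "(deriv ^^ j) f x = (deriv ^^ j) f z" for x z
      by (intro DERIV_isconst_all) auto
    moreover obtain z where "z \<notin> S" using S(2) by blast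
    then have "(deriv ^^ j) f z = 0" by (intro deriv_zero_outside[OF S(1)] S(3))
    ultimately show False using Suc by metis
  qed
qed (use nz in auto)


section \<open>Tensor products of functions of one variable\<close>

lemma partial_derivative_eq:
  "((\<lambda>t. f (x + t *\<^sub>R axis i 1)) has_real_derivative D) (at 0) \<Longrightarrow> partial_derivative i f x = D"
  by (simp add: partial_derivative_def DERIV_imp_deriv)

lemma iterated_partial_Nil [simp]: "iterated_partial [] f = f"
  and iterated_partial_Cons [simp]: "iterated_partial (i # is) f = partial_derivative i (iterated_partial is f)"
  and iterated_partial_append: "iterated_partial (is @ js) f = iterated_partial is (iterated_partial js f)"
  by (simp_all add: iterated_partial_def)

lemma smooth_iterated_partial: "smooth f \<Longrightarrow> smooth (iterated_partial is f)"
  by (simp add: smooth_def flip: iterated_partial_append)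

lemma smooth_continuous: "smooth f \<Longrightarrow> continuous_on S (iterated_partial is f)"
  unfolding smooth_def
  by (meson continuous_at_imp_continuous_on differentiable_imp_continuous_within)

lemma smooth_DERIV_partial:
  assumes "smooth f"
  shows "((\<lambda>t. f (x + t *\<^sub>R axis i 1)) has_real_derivative
           partial_derivative i f (x + t *\<^sub>R axis i 1)) (at t)"
proof -
  have "f differentiable (at y)" for y
    using assms[unfolded smooth_def, rule_format, of "[]" y] by simp
  then have 1: "(\<lambda>s. f (y + s *\<^sub>R axis i 1)) differentiable (at u)" for y u
    by (intro differentiable_compose[of f "\<lambda>s. y + s *\<^sub>R axis i 1"] differentiable_add
        differentiable_scaleR differentiable_const differentiable_ident)
  have "((\<lambda>s. f (x + t *\<^sub>R axis i 1 + s *\<^sub>R axis i 1)) has_real_derivative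
           partial_derivative i f (x + t *\<^sub>R axis i 1)) (at (0::real))"
    unfolding partial_derivative_def DERIV_deriv_iff_real_differentiable by (rule 1)
  then have "((\<lambda>s. f (x + (t + s) *\<^sub>R axis i 1)) has_real_derivative
           partial_derivative i f (x + t *\<^sub>R axis i 1)) (at (0::real))"
    by (simp only: scaleR_add_left add.assoc)
  then show ?thesis
    by (subst (asm) add.commute) (simp only: add_0_left DERIV_shift[of "\<lambda>s. f (x + s *\<^sub>R axis i 1)" _ 0 t, symmetric])
qed

definition tensor :: "('n::finite \<Rightarrow> real \<Rightarrow> real) \<Rightarrow> real^'n \<Rightarrow> real" where
  "tensor g x = (\<Prod>i\<in>UNIV. g i (x $ i))"

lemma tensor_differentiable:
  fixes g :: "'n::finite \<Rightarrow> real \<Rightarrow> real"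
  assumes "\<And>i y. g i differentiable (at y)"
  shows "tensor g differentiable (at x)"
proof -
  have "(\<lambda>x::real^'n. g i (x $ i)) differentiable (at x)" for i
    by (rule differentiable_compose[of "g i" "\<lambda>x. x $ i",
          OF assms differentiableI[OF bounded_linear_imp_has_derivative[OF bounded_linear_vec_nth]]])
  then obtain D where "((\<lambda>x::real^'n. g i (x $ i)) has_derivative D i) (at x)" for i
    unfolding differentiable_def by metis
  then have "(tensor g has_derivative (\<lambda>y. \<Sum>i\<in>UNIV. D i y * (\<Prod>j\<in>UNIV - {i}. g j (x $ j)))) (at x)"
    unfolding tensor_def[abs_def] by (intro has_derivative_prod)
  then show ?thesis by (rule differentiableI)
qed

lemma tensor_DERIV:
  assumes "g i differentiable (at (x $ i))"
  shows "((\<lambda>t. tensor g (x + t *\<^sub>R axis i 1)) has_real_derivative tensor (g(i := deriv (g i))) x) (at 0)"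
proof -
  have split: "tensor g' y = g' i (y $ i) * (\<Prod>j\<in>UNIV - {i}. g' j (y $ j))" for g' and y :: "real^'a"
    unfolding tensor_def by (subst prod.remove[of _ i]) auto
  have eq: "(\<lambda>t. tensor g (x + t *\<^sub>R axis i 1)) = (\<lambda>t. g i (t + x $ i) * (\<Prod>j\<in>UNIV - {i}. g j (x $ j)))"
    by (subst split) (auto simp: axis_def add.commute intro!: ext prod.cong)
  have "(g i has_real_derivative deriv (g i) (x $ i)) (at (0 + x $ i))"
    using assms by (simp add: DERIV_deriv_iff_real_differentiable)
  then have "((\<lambda>t. g i (t + x $ i)) has_real_derivative deriv (g i) (x $ i)) (at 0)"
    by (subst (asm) DERIV_shift)
  moreover have "tensor (g(i := deriv (g i))) x = deriv (g i) (x $ i) * (\<Prod>j\<in>UNIV - {i}. g j (x $ j))"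
    unfolding split[of "g(i := deriv (g i))"] by (simp cong: prod.cong_simp)
  ultimately show ?thesis
    unfolding eq by (simp only: DERIV_cmult_right)
qed

text \<open>The right-hand side depends on the list of directions only through its multiplicities. So for sums
  of tensors the symmetry of mixed partial derivatives comes for free.\<close>

lemma iterated_partial_sum_tensor:
  fixes g :: "'k \<Rightarrow> 'n::finite \<Rightarrow> real \<Rightarrow> real"
  assumes g: "\<And>k i. smooth_real (g k i)"
  shows "iterated_partial is (\<lambda>x. \<Sum>k\<in>K. c k * tensor (g k) x) =
     (\<lambda>x. \<Sum>k\<in>K. c k * tensor (\<lambda>i. (deriv ^^ count_list is i) (g k i)) x)"
proof (induction "is")
  case (Cons i js)
  let ?g = "\<lambda>k i. (deriv ^^ count_list js i) (g k i)"
  have upd: "(?g k)(i := deriv (?g k i)) = (\<lambda>j. (deriv ^^ count_list (i # js) j) (g k j))" for k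
    by (auto simp: fun_eq_iff)
  have "((\<lambda>t. \<Sum>k\<in>K. c k * tensor (?g k) (x + t *\<^sub>R axis i 1)) has_real_derivative
      (\<Sum>k\<in>K. c k * tensor ((?g k)(i := deriv (?g k i))) x)) (at 0)" for x
    using g unfolding smooth_real_def by (intro DERIV_sum DERIV_cmult tensor_DERIV) blast
  then show ?case unfolding iterated_partial_Cons Cons.IH upd
    by (intro ext partial_derivative_eq)
qed simp

lemma smooth_sum_tensor:
  fixes g :: "'k \<Rightarrow> 'n::finite \<Rightarrow> real \<Rightarrow> real"
  assumes "\<And>k i. smooth_real (g k i)" "finite K"
  shows "smooth (\<lambda>x. \<Sum>k\<in>K. c k * tensor (g k) x)"
  unfolding smooth_def iterated_partial_sum_tensor[OF assms(1)] using assms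
  by (auto intro!: differentiable_sum differentiable_mult tensor_differentiable simp: smooth_real_def)

lemma iterated_partial_sum_tensor_cong:
  fixes g :: "'k \<Rightarrow> 'n::finite \<Rightarrow> real \<Rightarrow> real"
  assumes "\<And>k i. smooth_real (g k i)" "\<And>i. count_list is i = count_list js i"
  shows "iterated_partial is (\<lambda>x. \<Sum>k\<in>K. c k * tensor (g k) x) =
         iterated_partial js (\<lambda>x. \<Sum>k\<in>K. c k * tensor (g k) x)"
  by (simp add: iterated_partial_sum_tensor assms)

lemma ex_list_of_multi_index: "\<exists>is. \<forall>i. count_list is i = (\<alpha> :: 'n::finite \<Rightarrow> nat) i"
proof -
  obtain "is" where "mset is = Abs_multiset \<alpha>" using ex_mset by blast
  then have "count (mset is) = \<alpha>" by (simp add: Abs_multiset_inverse)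
  then show ?thesis by (metis count_mset)
qed

text \<open>The enumeration of a multi-index that \<open>multi_derivative\<close> uses.\<close>

definition multi_index_list :: "('n::finite \<Rightarrow> nat) \<Rightarrow> 'n list" where
  "multi_index_list \<alpha> = (SOME is. \<forall>i. count_list is i = \<alpha> i)"

lemma count_multi_index_list: "count_list (multi_index_list \<alpha>) i = \<alpha> i"
  unfolding multi_index_list_def using someI_ex[OF ex_list_of_multi_index[of \<alpha>]] by blast

lemma length_multi_index_list: "length (multi_index_list \<alpha>) = index_order \<alpha>"
proof -
  have "(\<Sum>i\<in>UNIV. count_list (multi_index_list \<alpha>) i) = length (multi_index_list \<alpha>)"
    by (subst sum_count_set) auto
  then show ?thesis by (simp add: count_multi_index_list index_order_def)
qed

lemma multi_derivative_alt: "multi_derivative \<alpha> f = iterated_partial (multi_index_list \<alpha>) f"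
  by (simp add: multi_derivative_def multi_index_list_def)

lemma partial_derivative_zero_outside:
  assumes "closed S" "\<And>x. x \<notin> S \<Longrightarrow> f x = 0" "x \<notin> S"
  shows "partial_derivative i f x = 0"
proof (rule partial_derivative_eq)
  have "((\<lambda>t. x + t *\<^sub>R axis i 1) \<longlongrightarrow> x + 0 *\<^sub>R axis i 1) (nhds (0::real))"
    by (intro tendsto_intros filterlim_ident)
  moreover have "open (- S)" "x + 0 *\<^sub>R axis i 1 \<in> - S" using assms by auto
  ultimately have "eventually (\<lambda>t. x + t *\<^sub>R axis i 1 \<in> - S) (nhds (0::real))"
    by (rule topological_tendstoD)
  then have "eventually (\<lambda>t. f (x + t *\<^sub>R axis i 1) = 0) (nhds (0::real))"
    by eventually_elim (simp add: assms)
  then show "((\<lambda>t. f (x + t *\<^sub>R axis i 1)) has_real_derivative 0) (at 0)"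
    by (subst DERIV_cong_ev[OF refl _ refl]) auto
qed

lemma iterated_partial_zero_outside:
  assumes "closed S" "\<And>x. x \<notin> S \<Longrightarrow> f x = 0" "x \<notin> S"
  shows "iterated_partial is f x = 0"
  using assms(3) by (induction "is" arbitrary: x) (auto simp: assms(2) intro!: partial_derivative_zero_outside[OF assms(1)])


section \<open>Integration by parts\<close>

lemma integrable_continuous_compact_support:
  fixes f :: "'a::euclidean_space \<Rightarrow> real"
  assumes "continuous_on UNIV f" "compact S" "\<And>x. x \<notin> S \<Longrightarrow> f x = 0"
  shows "integrable lborel f"
proof -
  have "integrable lborel (\<lambda>x. indicator S x *\<^sub>R f x)"
    using assms by (intro borel_integrable_compact) (auto intro: continuous_on_subset)
  also have "(\<lambda>x. indicator S x *\<^sub>R f x) = f"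
    using assms(3) by (auto simp: indicator_def fun_eq_iff)
  finally show ?thesis .
qed

text \<open>By translation invariance the difference quotients of \<open>w\<close> along \<open>e\<close> have integral zero. They converge
  boundedly to \<open>dw\<close>, with a common bounded set off which they vanish, so dominated convergence
  applies.\<close>

lemma integral_directional_derivative_eq_0:
  fixes w dw :: "'a::euclidean_space \<Rightarrow> real"
  assumes D: "\<And>x t. ((\<lambda>t. w (x + t *\<^sub>R e)) has_real_derivative dw (x + t *\<^sub>R e)) (at t)"
    and cont: "continuous_on UNIV w" "continuous_on UNIV dw"
    and S: "compact S" "\<And>x. x \<notin> S \<Longrightarrow> w x = 0" "\<And>x. x \<notin> S \<Longrightarrow> dw x = 0"
  shows "(\<integral>x. dw x \<partial>lborel) = 0"
proof -
  define h where "h = (\<lambda>n. inverse (real (Suc n)))"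
  have h: "0 < h n" "h n \<le> 1" for n by (auto simp: h_def field_simps)
  define q where "q = (\<lambda>n x. (w (x + h n *\<^sub>R e) - w x) / h n)"
  have int_w: "integrable lborel w"
    using cont(1) S by (intro integrable_continuous_compact_support)
  have [measurable]: "w \<in> borel_measurable borel" "dw \<in> borel_measurable borel"
    using cont by (auto intro: borel_measurable_continuous_onI)
  have shift: "integrable lborel (\<lambda>x. w (x + c))" "(\<integral>x. w (x + c) \<partial>lborel) = (\<integral>x. w x \<partial>lborel)" for c
  proof -
    have "integrable (distr lborel borel ((+) c)) w" using int_w by (simp add: lborel_distr_plus)
    then show "integrable lborel (\<lambda>x. w (x + c))"
      by (subst (asm) integrable_distr_eq) (auto simp: add.commute)
    show "(\<integral>x. w (x + c) \<partial>lborel) = (\<integral>x. w x \<partial>lborel)"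
      using integral_distr[of "(+) c" lborel borel w] by (simp add: lborel_distr_plus add.commute)
  qed
  have q0: "(\<integral>x. q n x \<partial>lborel) = 0" for n
    unfolding q_def using shift int_w by simp
  obtain M where M: "\<bar>dw x\<bar> \<le> M" for x
  proof -
    have "bounded (dw ` S)"
      using S(1) cont(2) by (intro compact_imp_bounded compact_continuous_image) (auto intro: continuous_on_subset)
    then obtain M where "\<forall>x\<in>S. \<bar>dw x\<bar> \<le> M" by (auto simp: bounded_iff)
    then have "\<bar>dw x\<bar> \<le> max M 0" for x using S(3)[of x] by (cases "x \<in> S") (auto intro: max.coboundedI1)
    then show ?thesis using that by blast
  qed
  obtain R where R: "S \<subseteq> cball 0 R" using bounded_subset_ballD[OF compact_imp_bounded[OF S(1)], of 0] ball_subset_cball by (metis subset_trans)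
  have "(\<lambda>n. \<integral>x. q n x \<partial>lborel) \<longlonglongrightarrow> (\<integral>x. dw x \<partial>lborel)"
  proof (rule integral_dominated_convergence[where w = "\<lambda>x. indicator (cball 0 (R + norm e)) x *\<^sub>R M"])
    show "dw \<in> borel_measurable lborel" "\<And>n. q n \<in> borel_measurable lborel"
      unfolding q_def by measurable
    show "integrable lborel (\<lambda>x. indicator (cball 0 (R + norm e)) x *\<^sub>R M)"
      by (intro borel_integrable_compact) auto
    show "AE x in lborel. (\<lambda>n. q n x) \<longlonglongrightarrow> dw x"
    proof (rule AE_I2)
      fix x
      have "((\<lambda>t. (w (x + t *\<^sub>R e) - w x) / t) \<longlongrightarrow> dw x) (at 0)"
        using D[of x 0] by (simp add: has_field_derivative_iff)
      moreover have "h \<longlonglongrightarrow> 0" unfolding h_def by (rule LIMSEQ_inverse_real_of_nat)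
      then have "filterlim h (at 0) sequentially"
        unfolding filterlim_at using h(1) by (auto simp: less_le)
      ultimately show "(\<lambda>n. q n x) \<longlonglongrightarrow> dw x"
        unfolding q_def by (rule filterlim_compose)
    qed
    show "AE x in lborel. norm (q n x) \<le> indicator (cball 0 (R + norm e)) x *\<^sub>R M" for n
    proof (rule AE_I2)
      fix x
      obtain z where "w (x + h n *\<^sub>R e) - w (x + 0 *\<^sub>R e) = (h n - 0) * dw (x + z *\<^sub>R e)"
        using MVT2[of 0 "h n" "\<lambda>t. w (x + t *\<^sub>R e)" "\<lambda>t. dw (x + t *\<^sub>R e)", OF h(1) D] by blast
      then have "\<bar>q n x\<bar> \<le> M" using h[of n] M by (simp add: q_def)
      moreover have "q n x = 0" if "x \<notin> cball 0 (R + norm e)"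
      proof -
        have "norm (h n *\<^sub>R e) \<le> norm e" using h[of n] by (simp add: mult_left_le_one_le)
        then have "norm x \<le> norm (x + h n *\<^sub>R e) + norm e"
          using norm_triangle_ineq4[of "x + h n *\<^sub>R e" "h n *\<^sub>R e"] by simp
        moreover have R: "norm y \<le> R" if "y \<in> S" for y using R that by auto
        moreover have "norm x > R + norm e" using \<open>x \<notin> cball 0 (R + norm e)\<close> by simp
        ultimately have "x + h n *\<^sub>R e \<notin> S" "x \<notin> S"
          using norm_ge_zero[of e] R[of x] R[of "x + h n *\<^sub>R e"] by linarith+
        then show ?thesis by (simp add: q_def S(2))
      qed
      ultimately show "norm (q n x) \<le> indicator (cball 0 (R + norm e)) x *\<^sub>R M"
        by (auto simp: indicator_def)
    qed
  qed
  with q0 show ?thesis by (simp add: LIMSEQ_const_iff)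
qed

lemma integral_by_parts:
  fixes f \<psi> :: "real^'n::finite \<Rightarrow> real"
  assumes f: "smooth f" and \<psi>: "smooth \<psi>" and S: "compact S" "\<And>x. x \<notin> S \<Longrightarrow> f x = 0"
  shows "(\<integral>x. f x * partial_derivative i \<psi> x \<partial>lborel) = - (\<integral>x. partial_derivative i f x * \<psi> x \<partial>lborel)"
proof -
  note zero = S(2) partial_derivative_zero_outside[OF compact_imp_closed[OF S(1)] S(2)]
  have cont: "continuous_on UNIV f" "continuous_on UNIV \<psi>"
    "continuous_on UNIV (partial_derivative i f)" "continuous_on UNIV (partial_derivative i \<psi>)"
    using smooth_continuous[OF f, of _ "[]"] smooth_continuous[OF \<psi>, of _ "[]"]
      smooth_continuous[OF f, of _ "[i]"] smooth_continuous[OF \<psi>, of _ "[i]"] by simp_all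
  have "(\<integral>x. f x * partial_derivative i \<psi> x + partial_derivative i f x * \<psi> x \<partial>lborel) = 0"
  proof (rule integral_directional_derivative_eq_0[where w = "\<lambda>x. f x * \<psi> x" and e = "axis i 1" and S = S])
    show "((\<lambda>t. f (x + t *\<^sub>R axis i 1) * \<psi> (x + t *\<^sub>R axis i 1)) has_real_derivative
        f (x + t *\<^sub>R axis i 1) * partial_derivative i \<psi> (x + t *\<^sub>R axis i 1) +
        partial_derivative i f (x + t *\<^sub>R axis i 1) * \<psi> (x + t *\<^sub>R axis i 1)) (at t)" for x t
      by (rule DERIV_cong[OF DERIV_mult[OF smooth_DERIV_partial[OF f] smooth_DERIV_partial[OF \<psi>]]]) simp
  qed (use cont S(1) zero in \<open>auto intro!: continuous_intros\<close>)
  moreover have "integrable lborel (\<lambda>x. f x * partial_derivative i \<psi> x)"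
    "integrable lborel (\<lambda>x. partial_derivative i f x * \<psi> x)"
    using cont S(1) zero by (auto intro!: integrable_continuous_compact_support[where S = S] continuous_intros)
  ultimately show ?thesis by simp
qed

text \<open>Moving the derivatives from \<open>\<phi>\<close> to \<open>f\<close> one at a time reverses their order.\<close>

lemma integral_by_parts_iterated:
  fixes f \<phi> :: "real^'n::finite \<Rightarrow> real"
  assumes "smooth f" "smooth \<phi>" "compact S" "\<And>x. x \<notin> S \<Longrightarrow> f x = 0"
  shows "(\<integral>x. f x * iterated_partial is \<phi> x \<partial>lborel) =
     (-1) ^ length is * (\<integral>x. iterated_partial (rev is) f x * \<phi> x \<partial>lborel)"
  using assms(1,4)
proof (induction "is" arbitrary: f)
  case (Cons i js)
  have "smooth (partial_derivative i f)" "\<And>x. x \<notin> S \<Longrightarrow> partial_derivative i f x = 0"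
    using smooth_iterated_partial[OF Cons.prems(1), of "[i]"]
      partial_derivative_zero_outside[OF compact_imp_closed[OF assms(3)] Cons.prems(2)] by auto
  note IH = Cons.IH[OF this]
  show ?case
    using integral_by_parts[OF Cons.prems(1) smooth_iterated_partial[OF assms(2)] assms(3) Cons.prems(2), of i js] IH
    by (simp add: iterated_partial_append)
qed simp


section \<open>The fundamental lemma of the calculus of variations\<close>

lemma tensor_nonzero_iff: "tensor g x \<noteq> 0 \<longleftrightarrow> (\<forall>i. g i (x $ i) \<noteq> 0)"
  by (simp add: tensor_def)

definition box_bump :: "nat \<Rightarrow> real^'n::finite \<Rightarrow> real^'n \<Rightarrow> real^'n \<Rightarrow> real" where
  "box_bump n a b = tensor (\<lambda>i. bump (real (Suc n)) (a $ i) (b $ i))"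

lemma box_bump_nonzero_iff: "box_bump n a b x \<noteq> 0 \<longleftrightarrow> x \<in> box a b"
  by (simp add: box_bump_def tensor_nonzero_iff bump_eq_0_iff mem_box_cart)

lemma box_bump_bounds: "0 \<le> box_bump n a b x" "box_bump n a b x \<le> 1"
  unfolding box_bump_def tensor_def
  by (auto intro!: prod_nonneg prod_le_1 simp: bump_nonneg bump_le_1)

lemma smooth_box_bump: "smooth (box_bump n a b)"
  using smooth_sum_tensor[of "\<lambda>_ i. bump (real (Suc n)) (a $ i) (b $ i)" "{()}" "\<lambda>_. 1"]
  by (simp add: smooth_real_bump box_bump_def)

lemma box_bump_test_function:
  assumes "cbox a b \<subseteq> \<Omega>" shows "box_bump n a b \<in> test_functions \<Omega>"
proof -
  have "closure {x. box_bump n a b x \<noteq> 0} \<subseteq> cbox a b"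
    by (intro closure_minimal) (auto simp only: box_bump_nonzero_iff Collect_mem_eq box_subset_cbox closed_cbox)
  moreover from this have "compact (closure {x. box_bump n a b x \<noteq> 0})"
    by (meson bounded_cbox bounded_subset closed_closure compact_eq_bounded_closed)
  ultimately show ?thesis
    using assms smooth_box_bump unfolding test_functions_def by blast
qed

lemma box_bump_tendsto_indicator:
  "(\<lambda>n. box_bump n a b x) \<longlonglongrightarrow> indicator (box a b) (x :: real^'n::finite)"
proof -
  have "(\<lambda>n. box_bump n a b x) \<longlonglongrightarrow> (\<Prod>i\<in>UNIV. indicator {a $ i<..<b $ i} (x $ i))"
    unfolding box_bump_def tensor_def by (intro tendsto_prod bump_tendsto_indicator)
  also have "(\<Prod>i\<in>UNIV. indicator {a $ i<..<b $ i} (x $ i)) = (indicator (box a b) x :: real)"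
    by (auto simp: indicator_def mem_box_cart prod_zero_iff prod.If_cases split: if_splits)
  finally show ?thesis .
qed

text \<open>The test functions \<open>box_bump n a b\<close> take values in \<open>[0, 1]\<close>, have support in the closed box and converge
  pointwise to the indicator function of the open box.\<close>

lemma set_integral_box_eq_0:
  fixes g :: "real^'n::finite \<Rightarrow> real"
  assumes g: "locally_integrable \<Omega> g"
    and 0: "\<And>\<phi>. \<phi> \<in> test_functions \<Omega> \<Longrightarrow> (LINT x:\<Omega>|lebesgue. g x * \<phi> x) = 0"
    and sub: "cbox a b \<subseteq> \<Omega>"
  shows "(LINT x:box a b|lebesgue. g x) = 0"
proof -
  let ?g = "\<lambda>x. indicator (cbox a b) x * g x"
  have int: "integrable lebesgue ?g"
    using g sub unfolding locally_integrable_def set_integrable_def by simp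
  have meas: "box_bump n a b \<in> borel_measurable lebesgue" for n
  proof -
    have "box_bump n a b \<in> borel_measurable borel"
      using smooth_continuous[OF smooth_box_bump, of UNIV "[]" n a b]
      by (intro borel_measurable_continuous_onI) simp
    then show ?thesis by (intro measurable_completion) simp
  qed
  have "(\<lambda>n. \<integral>x. ?g x * box_bump n a b x \<partial>lebesgue) \<longlonglongrightarrow> (\<integral>x. ?g x * indicator (box a b) x \<partial>lebesgue)"
  proof (rule integral_dominated_convergence[where w = "\<lambda>x. norm (?g x)"])
    show "AE x in lebesgue. norm (?g x * box_bump n a b x) \<le> norm (?g x)" for n
      using box_bump_bounds[of n a b] by (auto simp: abs_mult intro!: AE_I2 mult_left_le)
    show "AE x in lebesgue. (\<lambda>n. ?g x * box_bump n a b x) \<longlonglongrightarrow> ?g x * indicator (box a b) x"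
      by (intro AE_I2 tendsto_mult tendsto_const box_bump_tendsto_indicator)
    show "(\<lambda>x. ?g x * indicator (box a b) x) \<in> borel_measurable lebesgue"
      by (rule borel_measurable_times[OF borel_measurable_integrable[OF int]]) (intro borel_measurable_indicator, simp)
    show "(\<lambda>x. ?g x * box_bump n a b x) \<in> borel_measurable lebesgue" for n
      by (rule borel_measurable_times[OF borel_measurable_integrable[OF int] meas])
  qed (use int in auto)
  moreover have "(\<integral>x. ?g x * box_bump n a b x \<partial>lebesgue) = (LINT x:\<Omega>|lebesgue. g x * box_bump n a b x)" for n
    unfolding set_lebesgue_integral_def using sub box_bump_nonzero_iff[of n a b] box_subset_cbox[of a b]
    by (intro Bochner_Integration.integral_cong refl) (auto simp: indicator_def)
  then have "(\<integral>x. ?g x * box_bump n a b x \<partial>lebesgue) = 0" for n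
    using 0[OF box_bump_test_function[OF sub]] by simp
  ultimately have "(\<integral>x. ?g x * indicator (box a b) x \<partial>lebesgue) = 0"
    by (simp add: LIMSEQ_const_iff)
  also have "(\<lambda>x. ?g x * indicator (box a b) x) = (\<lambda>x. indicator (box a b) x *\<^sub>R g x)"
    using box_subset_cbox[of a b] by (auto simp: indicator_def fun_eq_iff)
  finally show ?thesis unfolding set_lebesgue_integral_def .
qed

text \<open>Boxes form an intersection-stable generator of the Borel sets, and the Borel sets over which the
  integral of \<open>g\<close> vanishes form a Dynkin system. The integral over the whole space is needed for
  complements.\<close>

lemma AE_eq_0_if_box_integrals_0:
  fixes g :: "'a::euclidean_space \<Rightarrow> real"
  assumes int: "integrable lborel g"
    and 0: "\<And>a b. (LINT x:box a b|lborel. g x) = 0"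
    and total: "(\<integral>x. g x \<partial>lborel) = 0"
  shows "AE x in lborel. g x = 0"
proof (rule sigma_finite_measure.density_zero[OF sigma_finite_lborel int])
  fix A :: "'a set" assume A: "A \<in> sets lborel"
  have set_int: "set_integrable lborel A g" if "A \<in> sets borel" for A
    using that int unfolding set_integrable_def by (intro integrable_mult_indicator) auto
  have "Int_stable (range (\<lambda>(a, b). box a b :: 'a set))"
    by (auto simp: Int_stable_def box_Int_box)
  moreover have "range (\<lambda>(a, b). box a b :: 'a set) \<subseteq> Pow UNIV" by auto
  moreover have "A \<in> sigma_sets UNIV (range (\<lambda>(a, b). box a b))"
    using A by (simp add: borel_eq_box)
  ultimately show "(LINT x:A|lborel. g x) = 0"
  proof (induction rule: sigma_sets_induct_disjoint)
    case (basic A)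
    then show ?case using 0 by auto
  next
    case (compl A)
    then have A: "A \<in> sets borel" by (simp add: borel_eq_box)
    then have "(LINT x:A \<union> (UNIV - A)|lborel. g x) = (LINT x:A|lborel. g x) + (LINT x:UNIV - A|lborel. g x)"
      by (intro set_integral_Un set_int) auto
    with compl total show ?case by (simp add: set_lebesgue_integral_def)
  next
    case (union F)
    then have F: "F i \<in> sets borel" for i by (auto simp: borel_eq_box)
    then have "(LINT x:(\<Union>i. F i)|lborel. g x) = (\<Sum>i. LINT x:F i|lborel. g x)"
      using union(1) by (intro lebesgue_integral_countable_add set_int) (auto simp: disjoint_family_on_def)
    with union show ?case by simp
  qed (simp add: set_lebesgue_integral_def)
qed

text \<open>The Lebesgue measurable \<open>f\<close> is replaced by a Borel measurable function that agrees with it almost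
  everywhere.\<close>

lemma AE_lebesgue_eq_0_if_box_integrals_0:
  fixes f :: "'a::euclidean_space \<Rightarrow> real"
  assumes int: "integrable lebesgue f"
    and box_0: "\<And>a b. (\<integral>x. indicator (box a b) x * f x \<partial>lebesgue) = 0"
    and total: "(\<integral>x. f x \<partial>lebesgue) = 0"
  shows "AE x in lebesgue. f x = 0"
proof -
  note f = borel_measurable_integrable[OF int]
  obtain h where h [measurable]: "h \<in> borel_measurable lborel" and eq: "AE x in lborel. f x = h x"
    using completion_ex_borel_measurable_real[OF f] by blast
  have eq': "AE x in lebesgue. f x = h x" using eq by (rule AE_completion)
  have h': "h \<in> borel_measurable lebesgue" using h by (rule measurable_completion)
  have int_h: "integrable lborel h"
    using int integrable_cong_AE[OF f h' eq'] integrable_completion[OF h] by simp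
  have *: "(LINT x:A|lborel. h x) = (\<integral>x. indicator A x * f x \<partial>lebesgue)" if A [measurable]: "A \<in> sets borel" for A
  proof -
    have "(LINT x:A|lborel. h x) = (\<integral>x. indicator A x * h x \<partial>lebesgue)"
      unfolding set_lebesgue_integral_def by (subst integral_completion) auto
    also have "\<dots> = (\<integral>x. indicator A x * f x \<partial>lebesgue)"
    proof (rule integral_cong_AE)
      have A: "indicat_real A \<in> borel_measurable lebesgue"
        using A by (intro borel_measurable_indicator) auto
      show "(\<lambda>x. indicator A x * h x) \<in> borel_measurable lebesgue"
        by (rule borel_measurable_times[OF A h'])
      show "(\<lambda>x. indicator A x * f x) \<in> borel_measurable lebesgue"
        by (rule borel_measurable_times[OF A f])
      show "AE x in lebesgue. indicator A x * h x = indicator A x * f x"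
        using eq' by eventually_elim simp
    qed
    finally show ?thesis .
  qed
  have "AE x in lborel. h x = 0"
  proof (rule AE_eq_0_if_box_integrals_0[OF int_h])
    show "(LINT x:box a b|lborel. h x) = 0" for a b using *[of "box a b"] box_0 by simp
    show "(\<integral>x. h x \<partial>lborel) = 0"
      using *[of UNIV] total by (simp add: set_lebesgue_integral_def)
  qed
  then have "AE x in lebesgue. h x = 0" by (rule AE_completion)
  with eq' show ?thesis by eventually_elim simp
qed

lemma fundamental_lemma_of_variations:
  fixes g :: "real^'n::finite \<Rightarrow> real"
  assumes "open \<Omega>" and g: "locally_integrable \<Omega> g"
    and 0: "\<And>\<phi>. \<phi> \<in> test_functions \<Omega> \<Longrightarrow> (LINT x:\<Omega>|lebesgue. g x * \<phi> x) = 0"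
  shows "AE x in lebesgue. x \<in> \<Omega> \<longrightarrow> g x = 0"
proof -
  have *: "AE x in lebesgue. x \<in> cbox a b \<longrightarrow> g x = 0" if sub: "cbox a b \<subseteq> \<Omega>" for a b
  proof -
    \<comment> \<open>restricted to one box inside \<open>\<Omega>\<close>, the function \<open>g\<close> is integrable and has vanishing integrals over all boxes\<close>
    have box_0: "(\<integral>x. indicator (box c d) x * (indicator (box a b) x * g x) \<partial>lebesgue) = 0" for c d
    proof -
      obtain c' d' where eq: "box c d \<inter> box a b = box c' d'" by (auto simp: box_Int_box)
      show ?thesis
      proof (cases "box c' d' = {}")
        case True
        with eq have "(\<lambda>x. indicator (box c d) x * (indicator (box a b) x * g x)) = (\<lambda>x. 0)"
          by (auto simp: indicator_def fun_eq_iff)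
        then show ?thesis by simp
      next
        case False
        have "box c' d' \<subseteq> box a b" using eq by blast
        then have "cbox c' d' \<subseteq> cbox a b" using False
          using closure_mono[of "box c' d'" "box a b"] by (cases "box a b = {}") auto
        then have "(LINT x:box c' d'|lebesgue. g x) = 0"
          using sub by (intro set_integral_box_eq_0[OF g 0]) auto
        then show ?thesis unfolding set_lebesgue_integral_def eq[symmetric]
          by (simp add: indicator_inter_arith mult.assoc)
      qed
    qed
    have set_int: "set_integrable lebesgue (box a b) g"
    proof (rule set_integrable_subset[OF _ _ box_subset_cbox])
      show "set_integrable lebesgue (cbox a b) g"
        using g sub unfolding locally_integrable_def by (metis compact_cbox)
    qed simp
    have total: "(\<integral>x. indicator (box a b) x * g x \<partial>lebesgue) = 0"
      using set_integral_box_eq_0[OF g 0 sub] by (simp add: set_lebesgue_integral_def)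
    have "AE x in lebesgue. indicator (box a b) x * g x = 0"
      using set_int box_0 total
      by (intro AE_lebesgue_eq_0_if_box_integrals_0) (auto simp: set_integrable_def)
    \<comment> \<open>\<open>\<Omega>\<close> is a countable union of closed boxes, which differ from the open ones by null sets\<close>
    moreover have "AE x in lebesgue. x \<notin> cbox a b - box a b"
      using negligible_frontier_interval[of a b]
      by (intro AE_not_in) (simp add: negligible_iff_null_sets)
    ultimately show ?thesis by eventually_elim (auto simp: indicator_def split: if_splits)
  qed
  obtain \<D> where D: "countable \<D>" "\<D> \<subseteq> Pow \<Omega>" "\<And>X. X \<in> \<D> \<Longrightarrow> \<exists>a b. X = cbox a b" "\<Union>\<D> = \<Omega>"
    by (rule open_countable_Union_open_cbox[OF \<open>open \<Omega>\<close>], rule that)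
  have "AE x in lebesgue. \<forall>X\<in>\<D>. x \<in> X \<longrightarrow> g x = 0"
    unfolding AE_ball_countable[OF D(1)]
  proof
    fix X assume "X \<in> \<D>"
    with D(2,3) obtain a b where "X = cbox a b" "cbox a b \<subseteq> \<Omega>" by blast
    with * show "AE x in lebesgue. x \<in> X \<longrightarrow> g x = 0" by simp
  qed
  then show ?thesis by eventually_elim (use D(4) in blast)
qed


section \<open>Weak derivatives of smooth functions with compact support\<close>

text \<open>Lebesgue measure is complete, so that measurability passes to functions that agree almost everywhere.
  This matters because a weak derivative obtained by choice is only known up to null sets.\<close>

lemma lebesgue_integrable_cong_AE:
  fixes f g :: "'a::euclidean_space \<Rightarrow> real"
  assumes "AE x in lebesgue. f x = g x"
  shows "integrable lebesgue f \<longleftrightarrow> integrable lebesgue g"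
proof -
  have "integrable lebesgue g" if f: "integrable lebesgue f" and eq: "AE x in lebesgue. f x = g x"
    for f g :: "'a \<Rightarrow> real"
    using borel_measurable_integrable[OF f] borel_measurable_AE[OF borel_measurable_integrable[OF f] eq] eq f
    by (subst integrable_cong_AE[of g _ f]) (auto elim: eventually_mono)
  note * = this
  have "AE x in lebesgue. g x = f x" using assms by eventually_elim simp
  with assms * show ?thesis by metis
qed

lemma lebesgue_integral_cong_AE:
  fixes f g :: "'a::euclidean_space \<Rightarrow> real"
  assumes eq: "AE x in lebesgue. f x = g x"
  shows "(\<integral>x. f x \<partial>lebesgue) = (\<integral>x. g x \<partial>lebesgue)"
proof (cases "integrable lebesgue f")
  case True
  show ?thesis
    by (rule integral_cong_AE[OF borel_measurable_integrable[OF True]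
          borel_measurable_AE[OF borel_measurable_integrable[OF True] eq] eq])
next
  case False
  then show ?thesis using lebesgue_integrable_cong_AE[OF eq] by (simp add: not_integrable_integral_eq)
qed

lemma has_weak_derivative_cong_AE:
  assumes eq: "AE x in lebesgue. x \<in> \<Omega> \<longrightarrow> f x = f' x"
    and f: "has_weak_derivative \<Omega> \<alpha> f g"
  shows "has_weak_derivative \<Omega> \<alpha> f' g"
proof -
  have "set_integrable lebesgue K f'" if "K \<subseteq> \<Omega>" "set_integrable lebesgue K f" for K
  proof -
    have "AE x in lebesgue. indicator K x *\<^sub>R f x = indicator K x *\<^sub>R f' x"
      using eq by eventually_elim (use that(1) in \<open>auto simp: indicator_def\<close>)
    from lebesgue_integrable_cong_AE[OF this] that(2) show ?thesis by (simp add: set_integrable_def)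
  qed
  then have "locally_integrable \<Omega> f'"
    using f by (simp add: has_weak_derivative_def locally_integrable_def)
  moreover have "(LINT x:\<Omega>|lebesgue. f' x * \<psi> x) = (LINT x:\<Omega>|lebesgue. f x * \<psi> x)" for \<psi>
    unfolding set_lebesgue_integral_def
  proof (rule lebesgue_integral_cong_AE)
    show "AE x in lebesgue. indicator \<Omega> x *\<^sub>R (f' x * \<psi> x) = indicator \<Omega> x *\<^sub>R (f x * \<psi> x)"
      using eq by eventually_elim (auto simp: indicator_def)
  qed
  ultimately show ?thesis
    using f by (simp add: has_weak_derivative_def)
qed

lemma test_function_support:
  assumes "\<phi> \<in> test_functions \<Omega>"
  obtains K where "compact K" "K \<subseteq> \<Omega>" "\<And>x. x \<notin> K \<Longrightarrow> \<phi> x = 0" "smooth \<phi>"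
proof
  show "compact (closure {x. \<phi> x \<noteq> 0})" "closure {x. \<phi> x \<noteq> 0} \<subseteq> \<Omega>" "smooth \<phi>"
    using assms by (auto simp: test_functions_def)
  show "\<phi> x = 0" if "x \<notin> closure {x. \<phi> x \<noteq> 0}" for x
    using that closure_subset[of "{x. \<phi> x \<noteq> 0}"] by auto
qed

lemma set_integrable_times_compact_support:
  fixes g \<psi> :: "'a::euclidean_space \<Rightarrow> real"
  assumes g: "locally_integrable \<Omega> g" and K: "compact K" "K \<subseteq> \<Omega>" "\<And>x. x \<notin> K \<Longrightarrow> \<psi> x = 0"
    and \<psi>: "continuous_on UNIV \<psi>"
  shows "set_integrable lebesgue \<Omega> (\<lambda>x. g x * \<psi> x)"
proof -
  have int: "integrable lebesgue (\<lambda>x. indicator K x * g x)"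
    using g K unfolding locally_integrable_def set_integrable_def by simp
  have "bounded (\<psi> ` K)"
    using K(1) \<psi> by (intro compact_imp_bounded compact_continuous_image) (auto intro: continuous_on_subset)
  then obtain M where M: "\<And>x. x \<in> K \<Longrightarrow> \<bar>\<psi> x\<bar> \<le> M" by (auto simp: bounded_iff)
  have "\<psi> \<in> borel_measurable borel" using \<psi> by (rule borel_measurable_continuous_onI)
  then have meas: "\<psi> \<in> borel_measurable lebesgue" by (intro measurable_completion) simp
  have "integrable lebesgue (\<lambda>x. (indicator K x * g x) * \<psi> x)"
  proof (rule Bochner_Integration.integrable_bound[OF integrable_mult_right[OF int, of M]])
    show "(\<lambda>x. indicator K x * g x * \<psi> x) \<in> borel_measurable lebesgue"
      by (rule borel_measurable_times[OF borel_measurable_integrable[OF int] meas])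
    show "AE x in lebesgue. norm (indicator K x * g x * \<psi> x) \<le> norm (M * (indicator K x * g x))"
    proof (rule AE_I2)
      fix x
      show "norm (indicator K x * g x * \<psi> x) \<le> norm (M * (indicator K x * g x))"
        using mult_right_mono[OF order_trans[OF M abs_ge_self], of x "\<bar>g x\<bar>"]
        by (cases "x \<in> K") (auto simp: abs_mult mult.commute)
    qed
  qed
  also have "(\<lambda>x. (indicator K x * g x) * \<psi> x) = (\<lambda>x. indicator \<Omega> x *\<^sub>R (g x * \<psi> x))"
    using K(2,3) by (auto simp: indicator_def fun_eq_iff)
  finally show ?thesis unfolding set_integrable_def .
qed

lemma weak_derivative_unique:
  fixes f :: "real^'n::finite \<Rightarrow> real"
  assumes "open \<Omega>" and g: "has_weak_derivative \<Omega> \<alpha> f g" and g': "has_weak_derivative \<Omega> \<alpha> f g'"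
  shows "AE x in lebesgue. x \<in> \<Omega> \<longrightarrow> g x = g' x"
proof -
  have loc: "locally_integrable \<Omega> g" "locally_integrable \<Omega> g'"
    using g g' unfolding has_weak_derivative_def by auto
  have "AE x in lebesgue. x \<in> \<Omega> \<longrightarrow> g x - g' x = 0"
  proof (rule fundamental_lemma_of_variations[OF \<open>open \<Omega>\<close>])
    show "locally_integrable \<Omega> (\<lambda>x. g x - g' x)"
      using loc unfolding locally_integrable_def by (auto intro: set_integral_diff(1))
    fix \<phi> assume \<phi>: "\<phi> \<in> test_functions \<Omega>"
    obtain K where K: "compact K" "K \<subseteq> \<Omega>" "\<And>x. x \<notin> K \<Longrightarrow> \<phi> x = 0" and "smooth \<phi>"
      by (rule test_function_support[OF \<phi>], rule that)
    then have cont: "continuous_on UNIV \<phi>" using smooth_continuous[of \<phi> UNIV "[]"] by simp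
    have "(LINT x:\<Omega>|lebesgue. g x * \<phi> x - g' x * \<phi> x) =
          (LINT x:\<Omega>|lebesgue. g x * \<phi> x) - (LINT x:\<Omega>|lebesgue. g' x * \<phi> x)"
      by (intro set_integral_diff set_integrable_times_compact_support[OF _ K cont] loc)
    also have "\<dots> = 0"
    proof -
      have "(- 1) ^ index_order \<alpha> * (LINT x:\<Omega>|lebesgue. g x * \<phi> x) =
            (- 1) ^ index_order \<alpha> * (LINT x:\<Omega>|lebesgue. g' x * \<phi> x)"
        using g g' \<phi> by (simp add: has_weak_derivative_def)
      then show ?thesis by simp
    qed
    finally show "(LINT x:\<Omega>|lebesgue. (g x - g' x) * \<phi> x) = 0" by (simp add: left_diff_distrib)
  qed
  then show ?thesis by eventually_elim simp
qed

lemma lebesgue_set_integral_eq_lborel: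
  fixes f :: "'a::euclidean_space \<Rightarrow> real"
  assumes "f \<in> borel_measurable borel" "\<And>x. x \<notin> \<Omega> \<Longrightarrow> f x = 0"
  shows "(LINT x:\<Omega>|lebesgue. f x) = (\<integral>x. f x \<partial>lborel)"
proof -
  have "(\<lambda>x. indicator \<Omega> x *\<^sub>R f x) = f" using assms(2) by (auto simp: indicator_def fun_eq_iff)
  then show ?thesis using assms(1) by (simp add: set_lebesgue_integral_def integral_completion)
qed

lemma continuous_locally_integrable:
  fixes f :: "'a::euclidean_space \<Rightarrow> real"
  assumes "continuous_on UNIV f" shows "locally_integrable \<Omega> f"
  unfolding locally_integrable_def set_integrable_def
proof safe
  fix K :: "'a set" assume "compact K" "K \<subseteq> \<Omega>"
  then have "integrable lborel (\<lambda>x. indicator K x *\<^sub>R f x)"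
    using assms by (intro borel_integrable_compact) (auto intro: continuous_on_subset)
  then show "integrable lebesgue (\<lambda>x. indicator K x *\<^sub>R f x)"
    by (subst integrable_completion) (auto dest: borel_measurable_integrable)
qed

text \<open>Integration by parts yields the partial derivatives of \<open>f\<close> in reversed order. Symmetry of the iterated
  partial derivatives is therefore assumed; it is immediate for the functions of interest.\<close>

lemma smooth_has_weak_derivative:
  fixes f :: "real^'n::finite \<Rightarrow> real"
  assumes f: "smooth f" and S: "compact S" "S \<subseteq> \<Omega>" "\<And>x. x \<notin> S \<Longrightarrow> f x = 0"
    and symm: "\<And>is js. mset is = mset js \<Longrightarrow> iterated_partial is f = iterated_partial js f"
  shows "has_weak_derivative \<Omega> \<alpha> f (multi_derivative \<alpha> f)"
proof -
  let ?D = "iterated_partial (multi_index_list \<alpha>)"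
  have cont: "continuous_on UNIV f" "continuous_on UNIV (?D f)"
    using smooth_continuous[OF f, of _ "[]"] smooth_continuous[OF f] by simp_all
  have "(LINT x:\<Omega>|lebesgue. f x * ?D \<phi> x) = (- 1) ^ index_order \<alpha> * (LINT x:\<Omega>|lebesgue. ?D f x * \<phi> x)"
    if \<phi>: "\<phi> \<in> test_functions \<Omega>" for \<phi>
  proof -
    have sm: "smooth \<phi>" using \<phi> by (simp add: test_functions_def)
    have cont': "continuous_on UNIV \<phi>" "continuous_on UNIV (?D \<phi>)"
      using smooth_continuous[OF sm, of _ "[]"] smooth_continuous[OF sm] by simp_all
    have "(LINT x:\<Omega>|lebesgue. f x * ?D \<phi> x) = (\<integral>x. f x * ?D \<phi> x \<partial>lborel)"
      using S cont cont' by (intro lebesgue_set_integral_eq_lborel borel_measurable_continuous_onI continuous_intros) auto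
    also have "\<dots> = (- 1) ^ index_order \<alpha> * (\<integral>x. iterated_partial (rev (multi_index_list \<alpha>)) f x * \<phi> x \<partial>lborel)"
      using integral_by_parts_iterated[OF f sm S(1,3)] by (simp add: length_multi_index_list)
    also have "iterated_partial (rev (multi_index_list \<alpha>)) f = ?D f" by (rule symm) simp
    also have "(\<integral>x. ?D f x * \<phi> x \<partial>lborel) = (LINT x:\<Omega>|lebesgue. ?D f x * \<phi> x)"
    proof (rule lebesgue_set_integral_eq_lborel[symmetric])
      show "(\<lambda>x. ?D f x * \<phi> x) \<in> borel_measurable borel"
        using cont cont' by (intro borel_measurable_continuous_onI continuous_intros)
      show "?D f x * \<phi> x = 0" if "x \<notin> \<Omega>" for x
        using iterated_partial_zero_outside[of S f x] compact_imp_closed[OF S(1)] S(2,3) that by auto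
    qed
    finally show ?thesis .
  qed
  then show ?thesis
    unfolding has_weak_derivative_def multi_derivative_alt
    using cont continuous_locally_integrable by auto
qed

lemma rep_abs_aefun_AE:
  assumes "f \<in> borel_measurable lebesgue"
  shows "AE x in lebesgue. rep_aefun (abs_aefun f) x = f x"
proof -
  have "ae_rel f f" using assms by (simp add: ae_rel_def)
  then have "ae_rel f (rep_aefun (abs_aefun f))" by (rule rep_abs_rsp[OF Quotient3_aefun])
  then show ?thesis unfolding ae_rel_def by (auto elim: eventually_mono)
qed

text \<open>By uniqueness of weak derivatives, the chosen weak derivative of the chosen representative agrees almost
  everywhere with the classical derivative, so that the Sobolev norm can be computed from the latter.\<close>

lemma smooth_compact_support_sobolev:
  fixes f :: "real^'n::finite \<Rightarrow> real"
  assumes "open \<Omega>" and f: "smooth f" and S: "compact S" "S \<subseteq> \<Omega>" "\<And>x. x \<notin> S \<Longrightarrow> f x = 0"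
    and symm: "\<And>is js. mset is = mset js \<Longrightarrow> iterated_partial is f = iterated_partial js f"
    and p: "p > 0"
  shows "abs_aefun f \<in> sobolev_space \<Omega> A p"
    and "Lp_norm p \<Omega> (weak_derivative \<Omega> \<alpha> (rep_aefun (abs_aefun f))) =
           (\<integral>x. \<bar>multi_derivative \<alpha> f x\<bar> powr p \<partial>lborel) powr (1 / p)"
proof -
  let ?u = "rep_aefun (abs_aefun f)"
  have cont: "continuous_on UNIV f" "\<And>\<alpha>. continuous_on UNIV (multi_derivative \<alpha> f)"
    using smooth_continuous[OF f, of _ "[]"] smooth_continuous[OF f] by (simp_all add: multi_derivative_alt)
  have "f \<in> borel_measurable borel" using cont(1) by (rule borel_measurable_continuous_onI)
  then have eq: "AE x in lebesgue. ?u x = f x"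
    by (intro rep_abs_aefun_AE measurable_completion) simp
  have zero: "multi_derivative \<alpha> f x = 0" if "x \<notin> \<Omega>" for x \<alpha>
    unfolding multi_derivative_alt using that S
    by (intro iterated_partial_zero_outside[OF compact_imp_closed[OF S(1)] S(3)]) auto
  have weak: "has_weak_derivative \<Omega> \<alpha> ?u (multi_derivative \<alpha> f)" for \<alpha>
    using eq by (intro has_weak_derivative_cong_AE[OF _ smooth_has_weak_derivative[OF f S symm]])
      (auto elim: eventually_mono)
  then have "has_weak_derivative \<Omega> \<alpha> ?u (weak_derivative \<Omega> \<alpha> ?u)" for \<alpha>
    unfolding weak_derivative_def by (rule someI[of "has_weak_derivative \<Omega> \<alpha> ?u" for \<alpha>])
  then have AE: "AE x in lebesgue. x \<in> \<Omega> \<longrightarrow> weak_derivative \<Omega> \<alpha> ?u x = multi_derivative \<alpha> f x" for \<alpha>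
    using weak by (rule weak_derivative_unique[OF \<open>open \<Omega>\<close>])
  have zero': "multi_derivative \<alpha> f x = 0" if "x \<notin> S" for x \<alpha>
    unfolding multi_derivative_alt using that
    by (intro iterated_partial_zero_outside[OF compact_imp_closed[OF S(1)] S(3)]) auto
  have cont_powr: "continuous_on UNIV (\<lambda>x. \<bar>multi_derivative \<alpha> f x\<bar> powr p)" for \<alpha>
    using p by (intro continuous_on_powr' continuous_intros cont) auto
  have AE_powr: "AE x in lebesgue. indicator \<Omega> x *\<^sub>R \<bar>weak_derivative \<Omega> \<alpha> ?u x\<bar> powr p = \<bar>multi_derivative \<alpha> f x\<bar> powr p" for \<alpha>
    using AE[of \<alpha>] by eventually_elim (use zero in \<open>auto simp: indicator_def\<close>)
  have AE_1: "AE x in lebesgue. multi_derivative \<alpha> f x = indicator \<Omega> x *\<^sub>R weak_derivative \<Omega> \<alpha> ?u x" for \<alpha>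
    using AE[of \<alpha>] by eventually_elim (use zero in \<open>auto simp: indicator_def\<close>)
  have int: "integrable lborel (\<lambda>x. \<bar>multi_derivative \<alpha> f x\<bar> powr p)" for \<alpha>
    by (rule integrable_continuous_compact_support[OF cont_powr S(1)]) (simp add: zero')
  have "in_Lp p \<Omega> (weak_derivative \<Omega> \<alpha> ?u)" for \<alpha>
    unfolding in_Lp_def set_borel_measurable_def set_integrable_def
  proof
    have "multi_derivative \<alpha> f \<in> borel_measurable borel" using cont(2) by (rule borel_measurable_continuous_onI)
    then have "multi_derivative \<alpha> f \<in> borel_measurable lebesgue" by (intro measurable_completion) simp
    then show "(\<lambda>x. indicator \<Omega> x *\<^sub>R weak_derivative \<Omega> \<alpha> ?u x) \<in> borel_measurable lebesgue"
      using AE_1 by (rule borel_measurable_AE)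
    have "integrable lebesgue (\<lambda>x. \<bar>multi_derivative \<alpha> f x\<bar> powr p)"
      using int by (subst integrable_completion) (auto dest: borel_measurable_integrable)
    then show "integrable lebesgue (\<lambda>x. indicator \<Omega> x *\<^sub>R \<bar>weak_derivative \<Omega> \<alpha> ?u x\<bar> powr p)"
      using lebesgue_integrable_cong_AE[OF AE_powr] by simp
  qed
  moreover have "AE x in lebesgue. x \<notin> \<Omega> \<longrightarrow> ?u x = 0"
    using eq by eventually_elim (use S in auto)
  ultimately show "abs_aefun f \<in> sobolev_space \<Omega> A p"
    unfolding sobolev_space_def using weak by blast
  show "Lp_norm p \<Omega> (weak_derivative \<Omega> \<alpha> ?u) = (\<integral>x. \<bar>multi_derivative \<alpha> f x\<bar> powr p \<partial>lborel) powr (1 / p)"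
    unfolding Lp_norm_def set_lebesgue_integral_def lebesgue_integral_cong_AE[OF AE_powr]
    using borel_measurable_integrable[OF int] by (subst integral_completion) auto
qed


section \<open>Signed sums of small bumps and their Sobolev norms\<close>

text \<open>The support \<open>[1/4, 3/4]\<close> lies in the interior of the unit interval. Hence supports in different cells of
  the grid are disjoint, rather than merely disjoint up to a null set.\<close>

definition unit_bump :: "real \<Rightarrow> real" where
  "unit_bump = bump 1 (1/4) (3/4)"

text \<open>The derivative of multi-index \<open>\<alpha>\<close> of the bump in the unit cell.\<close>

definition profile :: "('n::finite \<Rightarrow> nat) \<Rightarrow> real^'n \<Rightarrow> real" where
  "profile \<alpha> = tensor (\<lambda>i. (deriv ^^ \<alpha> i) unit_bump)"

text \<open>The affine map that takes the \<open>k\<close>-th cell of side length \<open>h\<close> of the grid with corner \<open>a\<close> to the unit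
  cube.\<close>

definition cell_coord :: "real^'n::finite \<Rightarrow> real \<Rightarrow> ('n \<Rightarrow> nat) \<Rightarrow> real^'n \<Rightarrow> real^'n" where
  "cell_coord a h k x = (1 / h) *\<^sub>R (x - a) - (\<chi> i. real (k i))"

definition bump_sum ::
    "real^'n::finite \<Rightarrow> real \<Rightarrow> ('n \<Rightarrow> nat) set \<Rightarrow> (('n \<Rightarrow> nat) \<Rightarrow> real) \<Rightarrow> real^'n \<Rightarrow> real" where
  "bump_sum a h K \<epsilon> x =
     (\<Sum>k\<in>K. \<epsilon> k * tensor (\<lambda>i y. unit_bump ((1 / h) * y + (- (a $ i) / h - real (k i)))) x)"

lemma smooth_real_unit_bump: "smooth_real unit_bump"
  unfolding unit_bump_def by (rule smooth_real_bump)

lemma smooth_bump_sum: "finite K \<Longrightarrow> smooth (bump_sum a h K \<epsilon>)"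
  unfolding bump_sum_def[abs_def]
  by (intro smooth_sum_tensor smooth_real_affine smooth_real_unit_bump)

lemma bump_sum_symmetric:
  "mset is = mset js \<Longrightarrow> iterated_partial is (bump_sum a h K \<epsilon>) = iterated_partial js (bump_sum a h K \<epsilon>)"
  unfolding bump_sum_def[abs_def]
  by (intro iterated_partial_sum_tensor_cong smooth_real_affine smooth_real_unit_bump)
     (metis count_mset)

lemma multi_derivative_bump_sum:
  "multi_derivative \<alpha> (bump_sum a h K \<epsilon>) x =
     (1 / h) ^ index_order \<alpha> * (\<Sum>k\<in>K. \<epsilon> k * profile \<alpha> (cell_coord a h k x))"
proof -
  have "multi_derivative \<alpha> (bump_sum a h K \<epsilon>) x =
    (\<Sum>k\<in>K. \<epsilon> k * tensor (\<lambda>i. (deriv ^^ \<alpha> i) (\<lambda>y. unit_bump ((1 / h) * y + (- (a $ i) / h - real (k i))))) x)"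
    unfolding multi_derivative_alt bump_sum_def[abs_def]
    by (subst iterated_partial_sum_tensor)
       (auto simp only: count_multi_index_list intro!: smooth_real_affine smooth_real_unit_bump)
  also have "\<dots> = (\<Sum>k\<in>K. \<epsilon> k * ((1 / h) ^ index_order \<alpha> * profile \<alpha> (cell_coord a h k x)))"
  proof (intro sum.cong refl arg_cong2[where f = "(*)"])
    fix k
    have "(1 / h) * x $ i + (- (a $ i) / h - real (k i)) = cell_coord a h k x $ i" for i
      by (simp add: cell_coord_def diff_divide_distrib)
    then show "tensor (\<lambda>i. (deriv ^^ \<alpha> i) (\<lambda>y. unit_bump ((1 / h) * y + (- (a $ i) / h - real (k i))))) x =
       (1 / h) ^ index_order \<alpha> * profile \<alpha> (cell_coord a h k x)"
      by (simp only: tensor_def funpow_deriv_affine[OF smooth_real_unit_bump] prod.distrib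
          profile_def index_order_def power_sum)
  qed
  also have "\<dots> = (1 / h) ^ index_order \<alpha> * (\<Sum>k\<in>K. \<epsilon> k * profile \<alpha> (cell_coord a h k x))"
    by (simp add: sum_distrib_left mult_ac)
  finally show ?thesis .
qed

lemma bump_sum_eq: "bump_sum a h K \<epsilon> x = (\<Sum>k\<in>K. \<epsilon> k * profile (\<lambda>_. 0) (cell_coord a h k x))"
proof -
  have "(1 / h) * x $ i + (- (a $ i) / h - real (k i)) = cell_coord a h k x $ i" for i k
    by (simp add: cell_coord_def diff_divide_distrib)
  then show ?thesis by (simp only: bump_sum_def profile_def tensor_def funpow_0)
qed

lemma profile_nonzero_imp:
  assumes "profile \<alpha> y \<noteq> 0" shows "y $ i \<in> {1/4..3/4}"
proof (rule ccontr)
  assume "y $ i \<notin> {1/4..3/4}"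
  moreover have "unit_bump x = 0" if "x \<notin> {1/4..3/4}" for x
    unfolding unit_bump_def using that by (subst bump_eq_0_iff) auto
  ultimately have "(deriv ^^ \<alpha> i) unit_bump (y $ i) = 0"
    by (intro deriv_zero_outside[of "{1/4..3/4}"]) auto
  with assms show False by (auto simp: profile_def tensor_nonzero_iff)
qed

lemma continuous_profile: "continuous_on UNIV (profile \<alpha>)"
proof -
  have "continuous_on UNIV (\<lambda>x::real^'a. (deriv ^^ \<alpha> i) unit_bump (x $ i))" for i
    using smooth_real_continuous[OF smooth_real_unit_bump]
    by (rule continuous_on_compose2) (auto intro: continuous_intros)
  then show ?thesis unfolding profile_def tensor_def[abs_def] by (intro continuous_on_prod)
qed

lemma ex_profile_nonzero: "\<exists>y. profile \<alpha> y \<noteq> 0"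
proof -
  have "\<exists>x. (deriv ^^ j) unit_bump x \<noteq> 0" for j
  proof (rule smooth_real_deriv_nonzero[OF smooth_real_unit_bump, of "{1/4..3/4}" "1/2"])
    show "{1/4..3/4::real} \<noteq> UNIV" using UNIV_I[of "0::real"] by fastforce
    show "unit_bump x = 0" if "x \<notin> {1/4..3/4}" for x
      unfolding unit_bump_def using that by (subst bump_eq_0_iff) auto
    show "unit_bump (1/2) \<noteq> 0" unfolding unit_bump_def by (subst bump_eq_0_iff) auto
  qed simp
  then obtain y where "(deriv ^^ j) unit_bump (y j) \<noteq> 0" for j by metis
  then show ?thesis
    by (intro exI[of _ "\<chi> i. y (\<alpha> i)"]) (simp add: profile_def tensor_nonzero_iff)
qed

definition profile_integral :: "('n::finite \<Rightarrow> nat) \<Rightarrow> real \<Rightarrow> real" where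
  "profile_integral \<alpha> p = (\<integral>y. \<bar>profile \<alpha> y\<bar> powr p \<partial>lborel)"

lemma continuous_profile_powr: "p > 0 \<Longrightarrow> continuous_on UNIV (\<lambda>y. \<bar>profile \<alpha> y\<bar> powr p)"
  by (intro continuous_on_powr' continuous_intros continuous_profile) auto

lemma profile_powr_integrable:
  assumes "p > 0" shows "integrable lborel (\<lambda>y. \<bar>profile \<alpha> y\<bar> powr p)"
proof (rule integrable_continuous_compact_support[OF continuous_profile_powr[OF assms] compact_cbox])
  show "\<bar>profile \<alpha> y\<bar> powr p = 0" if "y \<notin> cbox (\<chi> i. 1/4) (\<chi> i. 3/4)" for y
    using that profile_nonzero_imp[of \<alpha> y] by (auto simp: mem_box_cart)
qed

lemma profile_integral_pos:
  assumes "p > 0" shows "profile_integral \<alpha> p > 0"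
proof -
  obtain y where y: "profile \<alpha> y \<noteq> 0" using ex_profile_nonzero by blast
  let ?U = "{y. profile \<alpha> y \<noteq> 0}"
  have "open ?U" using continuous_profile by (intro open_Collect_neq continuous_on_const)
  then have "\<not> negligible ?U" using y open_not_negligible by blast
  moreover have "?U \<in> null_sets lebesgue" if "AE y in lborel. \<bar>profile \<alpha> y\<bar> powr p = 0"
    using AE_completion[OF that] by (simp add: completion.AE_iff_null_sets)
  ultimately have "\<not> (AE y in lborel. \<bar>profile \<alpha> y\<bar> powr p = 0)"
    by (metis negligible_iff_null_sets)
  then have "profile_integral \<alpha> p \<noteq> 0"
    unfolding profile_integral_def
    by (subst integral_nonneg_eq_0_iff_AE[OF profile_powr_integrable[OF assms]]) auto
  moreover have "profile_integral \<alpha> p \<ge> 0" unfolding profile_integral_def by (intro integral_nonneg_AE) auto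
  ultimately show ?thesis by simp
qed

lemma profile_cells_disjoint:
  assumes "profile \<alpha> (cell_coord a h k x) \<noteq> 0" "profile \<alpha> (cell_coord a h l x) \<noteq> 0"
  shows "k = l"
proof
  fix i
  have "cell_coord a h k x $ i \<in> {1/4..3/4}" "cell_coord a h l x $ i \<in> {1/4..3/4}"
    using assms by (auto intro: profile_nonzero_imp simp del: atLeastAtMost_iff)
  then have "\<bar>real (k i) - real (l i)\<bar> < 1" by (simp add: cell_coord_def)
  then show "k i = l i" by linarith
qed

text \<open>Applied pointwise to bumps with disjoint supports, of which at most one differs from zero at a given point:
  signs disappear and powers are additive.\<close>

lemma abs_sum_powr_single:
  fixes c \<epsilon> :: "'k \<Rightarrow> real"
  assumes "finite K" "\<And>k. \<bar>\<epsilon> k\<bar> = 1" "\<And>k l. c k \<noteq> 0 \<Longrightarrow> c l \<noteq> 0 \<Longrightarrow> k = l"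
  shows "\<bar>\<Sum>k\<in>K. \<epsilon> k * c k\<bar> powr p = (\<Sum>k\<in>K. \<bar>c k\<bar> powr p)"
proof (cases "\<exists>j\<in>K. c j \<noteq> 0")
  case True
  then obtain j where j: "j \<in> K" "c j \<noteq> 0" by blast
  have 0: "c k = 0" if "k \<in> K - {j}" for k using assms(3)[of k j] j that by auto
  have "(\<Sum>k\<in>K. \<epsilon> k * c k) = \<epsilon> j * c j" "(\<Sum>k\<in>K. \<bar>c k\<bar> powr p) = \<bar>c j\<bar> powr p"
    using 0 by (simp_all add: sum.remove[OF assms(1) j(1)])
  then show ?thesis by (simp add: abs_mult assms(2))
qed simp

lemma lborel_integral_affine:
  fixes f :: "'a::euclidean_space \<Rightarrow> real"
  assumes c: "c \<noteq> 0" and [measurable]: "f \<in> borel_measurable borel"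
  shows "(\<integral>x. f x \<partial>lborel) = \<bar>c\<bar> ^ DIM('a) * (\<integral>x. f (t + c *\<^sub>R x) \<partial>lborel)"
proof -
  have "(\<integral>x. f x \<partial>lborel) = (\<integral>x. f x \<partial>density (distr lborel borel (\<lambda>x. t + c *\<^sub>R x)) (\<lambda>_. ennreal (\<bar>c\<bar> ^ DIM('a))))"
    using lborel_affine[OF c, of t] by (simp add: ennreal_power)
  also have "\<dots> = \<bar>c\<bar> ^ DIM('a) * (\<integral>x. f (t + c *\<^sub>R x) \<partial>lborel)"
    by (subst integral_density) (auto simp: integral_distr)
  finally show ?thesis .
qed

text \<open>Substitution of \<open>cell_coord\<close>, which has Jacobian \<open>h\<^sup>-\<^sup>d\<close>.\<close>

lemma integral_profile_cell:
  fixes a :: "real^'n::finite"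
  assumes "h > 0" "p > 0"
  shows "(\<integral>x. \<bar>profile \<alpha> (cell_coord a h k x)\<bar> powr p \<partial>lborel) = h ^ CARD('n) * profile_integral \<alpha> p"
    and "integrable lborel (\<lambda>x. \<bar>profile \<alpha> (cell_coord a h k x)\<bar> powr p)"
proof -
  let ?t = "a + h *\<^sub>R (\<chi> i. real (k i))"
  let ?f = "\<lambda>x. \<bar>profile \<alpha> (cell_coord a h k x)\<bar> powr p"
  have cell: "cell_coord a h k (?t + h *\<^sub>R y) = y" for y
    using assms(1) by (simp add: cell_coord_def vec_eq_iff field_simps)
  have cont: "continuous_on UNIV ?f"
    unfolding cell_coord_def using continuous_profile_powr[OF assms(2)]
    by (rule continuous_on_compose2) (auto intro!: continuous_intros)
  then have meas: "?f \<in> borel_measurable borel" by (rule borel_measurable_continuous_onI)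
  show "integral\<^sup>L lborel ?f = h ^ CARD('n) * profile_integral \<alpha> p"
    using lborel_integral_affine[OF _ meas, of h ?t] assms(1) by (simp add: cell profile_integral_def)
  then show "integrable lborel ?f"
    using profile_integral_pos[OF assms(2), of \<alpha>] assms(1) not_integrable_integral_eq[of lborel ?f]
    by (metis mult_pos_pos order_less_irrefl zero_less_power)
qed

lemma Lp_norm_multi_derivative_bump_sum:
  fixes a :: "real^'n::finite"
  assumes "h > 0" "p > 0" "finite K" and \<epsilon>: "\<And>k. \<bar>\<epsilon> k\<bar> = 1"
  shows "(\<integral>x. \<bar>multi_derivative \<alpha> (bump_sum a h K \<epsilon>) x\<bar> powr p \<partial>lborel) powr (1 / p) =
    (1 / h) ^ index_order \<alpha> * (real (card K) * h ^ CARD('n)) powr (1 / p) * profile_integral \<alpha> p powr (1 / p)"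
proof -
  let ?c = "(1 / h) ^ index_order \<alpha>"
  have "\<bar>multi_derivative \<alpha> (bump_sum a h K \<epsilon>) x\<bar> powr p =
      ?c powr p * (\<Sum>k\<in>K. \<bar>profile \<alpha> (cell_coord a h k x)\<bar> powr p)" for x
  proof -
    have "\<bar>multi_derivative \<alpha> (bump_sum a h K \<epsilon>) x\<bar> powr p =
       (?c * \<bar>\<Sum>k\<in>K. \<epsilon> k * profile \<alpha> (cell_coord a h k x)\<bar>) powr p"
      using assms(1) by (simp add: multi_derivative_bump_sum abs_mult)
    also have "\<dots> = ?c powr p * \<bar>\<Sum>k\<in>K. \<epsilon> k * profile \<alpha> (cell_coord a h k x)\<bar> powr p"
      by (rule powr_mult)
    also have "\<bar>\<Sum>k\<in>K. \<epsilon> k * profile \<alpha> (cell_coord a h k x)\<bar> powr p =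
        (\<Sum>k\<in>K. \<bar>profile \<alpha> (cell_coord a h k x)\<bar> powr p)"
      by (rule abs_sum_powr_single[OF assms(3) \<epsilon>]) (rule profile_cells_disjoint)
    finally show ?thesis .
  qed
  then have "(\<integral>x. \<bar>multi_derivative \<alpha> (bump_sum a h K \<epsilon>) x\<bar> powr p \<partial>lborel) =
      ?c powr p * (real (card K) * h ^ CARD('n) * profile_integral \<alpha> p)"
    using integral_profile_cell[OF assms(1,2), of \<alpha> a] by (simp add: mult.assoc)
  moreover have "(?c powr p * (real (card K) * h ^ CARD('n) * profile_integral \<alpha> p)) powr (1 / p) =
     ?c * (real (card K) * h ^ CARD('n)) powr (1 / p) * profile_integral \<alpha> p powr (1 / p)"
    using assms(1,2) profile_integral_pos[OF assms(2), of \<alpha>]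
    by (simp add: powr_mult powr_powr del: power_divide)
  ultimately show ?thesis by simp
qed

definition grid :: "nat \<Rightarrow> ('n::finite \<Rightarrow> nat) set" where
  "grid m = {k. \<forall>i. k i < m}"

lemma grid_eq_PiE: "grid m = (\<Pi>\<^sub>E i\<in>UNIV. {..<m})"
  by (auto simp: grid_def PiE_def)

lemma finite_grid: "finite (grid m)"
  unfolding grid_eq_PiE by (intro finite_PiE) auto

lemma card_grid: "card (grid m :: ('n::finite \<Rightarrow> nat) set) = m ^ CARD('n)"
  unfolding grid_eq_PiE by (subst card_PiE) auto

lemma bump_sum_zero_outside:
  assumes "h > 0" "K \<subseteq> grid m" "x \<notin> cbox a (a + (\<chi> i. real m * h))"
  shows "bump_sum a h K \<epsilon> x = 0"
  unfolding bump_sum_eq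
proof (rule sum.neutral, safe)
  fix k assume "k \<in> K"
  obtain i where i: "x $ i < a $ i \<or> x $ i > a $ i + real m * h"
    using assms(3) by (force simp: mem_box_cart not_le)
  have "profile (\<lambda>_. 0) (cell_coord a h k x) = 0"
  proof (rule ccontr)
    assume "\<not> ?thesis"
    then have "cell_coord a h k x $ i \<in> {1/4..3/4}" by (rule profile_nonzero_imp)
    moreover have "cell_coord a h k x $ i = (x $ i - a $ i) / h - real (k i)"
      by (simp add: cell_coord_def)
    ultimately have "0 \<le> (x $ i - a $ i) / h - real (k i)" "(x $ i - a $ i) / h - real (k i) \<le> 1"
      unfolding atLeastAtMost_iff by linarith+
    moreover have "k i < m" using \<open>k \<in> K\<close> assms(2) by (auto simp: grid_def)
    then have "real (k i) + 1 \<le> real m" by linarith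
    ultimately have "0 \<le> (x $ i - a $ i) / h" "(x $ i - a $ i) / h \<le> real m" by linarith+
    then show False using i assms(1) by (auto simp: field_simps)
  qed
  then show "\<epsilon> k * profile (\<lambda>_. 0) (cell_coord a h k x) = 0" by simp
qed

lemma bump_sum_measurable: "finite K \<Longrightarrow> bump_sum a h K \<epsilon> \<in> borel_measurable lebesgue"
proof -
  assume "finite K"
  then have "bump_sum a h K \<epsilon> \<in> borel_measurable borel"
    using smooth_continuous[OF smooth_bump_sum, of K UNIV "[]"]
    by (intro borel_measurable_continuous_onI) simp
  then show ?thesis by (intro measurable_completion) simp
qed

lemma abs_aefun_bump_sum:
  assumes "finite K"
  shows "abs_aefun (bump_sum a h K \<epsilon>) = (\<Sum>k\<in>K. \<epsilon> k *\<^sub>R abs_aefun (bump_sum a h {k} (\<lambda>_. 1)))"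
  using assms
proof induction
  case empty
  have "bump_sum a h {} \<epsilon> = (\<lambda>_. 0)" by (simp add: bump_sum_def fun_eq_iff)
  then show ?case by (simp add: zero_aefun_def)
next
  case (insert k K)
  have refl: "ae_rel f f" if "f \<in> borel_measurable lebesgue" for f :: "real^'a \<Rightarrow> real"
    using that by (simp add: ae_rel_def)
  have m: "bump_sum a h {k} (\<lambda>_. 1) \<in> borel_measurable lebesgue" "bump_sum a h K \<epsilon> \<in> borel_measurable lebesgue"
    using insert by (simp_all add: bump_sum_measurable)
  have "bump_sum a h (insert k K) \<epsilon> = (\<lambda>x. \<epsilon> k * bump_sum a h {k} (\<lambda>_. 1) x + bump_sum a h K \<epsilon> x)"
    using insert by (simp add: bump_sum_def fun_eq_iff)
  then have "abs_aefun (bump_sum a h (insert k K) \<epsilon>) =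
      abs_aefun (\<lambda>x. \<epsilon> k * bump_sum a h {k} (\<lambda>_. 1) x) + abs_aefun (bump_sum a h K \<epsilon>)"
    using m by (subst plus_aefun.abs_eq) (auto intro!: refl)
  also have "abs_aefun (\<lambda>x. \<epsilon> k * bump_sum a h {k} (\<lambda>_. 1) x) = \<epsilon> k *\<^sub>R abs_aefun (bump_sum a h {k} (\<lambda>_. 1))"
    using m by (subst scaleR_aefun.abs_eq) (auto intro!: refl)
  finally show ?case using insert by simp
qed

lemma bump_sum_sobolev:
  fixes a :: "real^'n::finite"
  assumes "open \<Omega>" "h > 0" "p > 0" "K \<subseteq> grid m" and sub: "cbox a (a + (\<chi> i. real m * h)) \<subseteq> \<Omega>"
  shows "abs_aefun (bump_sum a h K \<epsilon>) \<in> sobolev_space \<Omega> A p"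
    and "(\<And>k. \<bar>\<epsilon> k\<bar> = 1) \<Longrightarrow> Lp_norm p \<Omega> (weak_derivative \<Omega> \<alpha> (rep_aefun (abs_aefun (bump_sum a h K \<epsilon>)))) =
      (1 / h) ^ index_order \<alpha> * (real (card K) * h ^ CARD('n)) powr (1 / p) * profile_integral \<alpha> p powr (1 / p)"
proof -
  have K: "finite K" using assms(4) finite_grid finite_subset by blast
  note * = smooth_compact_support_sobolev[OF assms(1) smooth_bump_sum[OF K] compact_cbox sub
      bump_sum_zero_outside[OF assms(2,4)] bump_sum_symmetric assms(3)]
  show "abs_aefun (bump_sum a h K \<epsilon>) \<in> sobolev_space \<Omega> A p" by (rule *)
  show "Lp_norm p \<Omega> (weak_derivative \<Omega> \<alpha> (rep_aefun (abs_aefun (bump_sum a h K \<epsilon>)))) =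
      (1 / h) ^ index_order \<alpha> * (real (card K) * h ^ CARD('n)) powr (1 / p) * profile_integral \<alpha> p powr (1 / p)"
    if "\<And>k. \<bar>\<epsilon> k\<bar> = 1"
    by (rule trans[OF *(2) Lp_norm_multi_derivative_bump_sum[OF assms(2,3) K that]])
qed

text \<open>The constant depends neither on the cell size nor on the family of cells nor on the signs. As \<open>h \<le> 1\<close>,
  the derivatives of highest order dominate.\<close>

lemma sobolev_norm_bump_sum_le:
  fixes A :: "('n::finite \<Rightarrow> nat) set"
  assumes "coherent A" "p > 0"
  shows "\<exists>C>0. \<forall>\<Omega> h m K a \<epsilon>. open \<Omega> \<longrightarrow> 0 < h \<longrightarrow> h \<le> 1 \<longrightarrow> K \<subseteq> grid m \<longrightarrow>
      cbox a (a + (\<chi> i. real m * h)) \<subseteq> \<Omega> \<longrightarrow> (\<forall>k. \<bar>\<epsilon> k\<bar> = 1) \<longrightarrow>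
      sobolev_norm \<Omega> A p (abs_aefun (bump_sum a h K \<epsilon>)) \<le>
        C * ((1 / h) ^ set_order A * (real (card K) * h ^ CARD('n)) powr (1 / p))"
proof -
  have A: "finite A" "A \<noteq> {}" using assms(1) by (auto simp: coherent_def)
  define C where "C = (\<Sum>\<alpha>\<in>A. profile_integral \<alpha> p powr (1 / p))"
  have C: "C > 0" unfolding C_def
    using A by (intro sum_pos) (simp_all add: less_imp_neq[OF profile_integral_pos[OF assms(2)], symmetric])
  show ?thesis
  proof (intro exI[of _ C] conjI C allI impI)
    fix \<Omega> :: "(real^'n) set" and h m and K :: "('n \<Rightarrow> nat) set" and a and \<epsilon> :: "('n \<Rightarrow> nat) \<Rightarrow> real"
    assume *: "open \<Omega>" "0 < h" "h \<le> 1" "K \<subseteq> grid m" "cbox a (a + (\<chi> i. real m * h)) \<subseteq> \<Omega>" "\<forall>k. \<bar>\<epsilon> k\<bar> = 1"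
    show "sobolev_norm \<Omega> A p (abs_aefun (bump_sum a h K \<epsilon>)) \<le>
          C * ((1 / h) ^ set_order A * (real (card K) * h ^ CARD('n)) powr (1 / p))"
      unfolding sobolev_norm_def
    proof (rule cSUP_least[OF A(2)])
      fix \<alpha> assume \<alpha>: "\<alpha> \<in> A"
      have "index_order \<alpha> \<le> set_order A" unfolding set_order_def using A \<alpha> by (intro Max_ge) auto
      then have le: "(1 / h) ^ index_order \<alpha> \<le> (1 / h) ^ set_order A"
        using *(2,3) by (intro power_increasing) auto
      have "profile_integral \<alpha> p powr (1 / p) \<le> C"
        unfolding C_def using A \<alpha> by (intro member_le_sum) auto
      then have "((1 / h) ^ index_order \<alpha> * (real (card K) * h ^ CARD('n)) powr (1 / p)) * profile_integral \<alpha> p powr (1 / p)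
          \<le> ((1 / h) ^ set_order A * (real (card K) * h ^ CARD('n)) powr (1 / p)) * C"
        using le *(2) by (intro mult_mono) auto
      then show "Lp_norm p \<Omega> (weak_derivative \<Omega> \<alpha> (rep_aefun (abs_aefun (bump_sum a h K \<epsilon>)))) \<le>
          C * ((1 / h) ^ set_order A * (real (card K) * h ^ CARD('n)) powr (1 / p))"
        unfolding bump_sum_sobolev(2)[OF *(1,2) assms(2) *(4,5) *(6)[rule_format]] by (simp only: mult.commute)
    qed
  qed
qed

text \<open>A single derivative of maximal order already gives the lower bound.\<close>

lemma sobolev_norm_bump_sum_ge:
  fixes B :: "('n::finite \<Rightarrow> nat) set"
  assumes "coherent B" "p > 0"
  shows "\<exists>c>0. \<forall>\<Omega> h m K a \<epsilon>. open \<Omega> \<longrightarrow> 0 < h \<longrightarrow> K \<subseteq> grid m \<longrightarrow>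
      cbox a (a + (\<chi> i. real m * h)) \<subseteq> \<Omega> \<longrightarrow> (\<forall>k. \<bar>\<epsilon> k\<bar> = 1) \<longrightarrow>
      c * ((1 / h) ^ set_order B * (real (card K) * h ^ CARD('n)) powr (1 / p))
      \<le> sobolev_norm \<Omega> B p (abs_aefun (bump_sum a h K \<epsilon>))"
proof -
  have B: "finite B" "B \<noteq> {}" using assms(1) by (auto simp: coherent_def)
  then have "set_order B \<in> index_order ` B" unfolding set_order_def by (intro Max_in) auto
  then obtain \<beta> where \<beta>: "\<beta> \<in> B" "index_order \<beta> = set_order B" by auto
  show ?thesis
  proof (intro exI[of _ "profile_integral \<beta> p powr (1 / p)"] conjI allI impI)
    show "profile_integral \<beta> p powr (1 / p) > 0" using profile_integral_pos[OF assms(2), of \<beta>] by simp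
    fix \<Omega> :: "(real^'n) set" and h m and K :: "('n \<Rightarrow> nat) set" and a and \<epsilon> :: "('n \<Rightarrow> nat) \<Rightarrow> real"
    assume *: "open \<Omega>" "0 < h" "K \<subseteq> grid m" "cbox a (a + (\<chi> i. real m * h)) \<subseteq> \<Omega>" "\<forall>k. \<bar>\<epsilon> k\<bar> = 1"
    have "Lp_norm p \<Omega> (weak_derivative \<Omega> \<beta> (rep_aefun (abs_aefun (bump_sum a h K \<epsilon>))))
        \<le> sobolev_norm \<Omega> B p (abs_aefun (bump_sum a h K \<epsilon>))"
      unfolding sobolev_norm_def using B \<beta>(1) by (intro cSUP_upper) auto
    then show "profile_integral \<beta> p powr (1 / p) * ((1 / h) ^ set_order B * (real (card K) * h ^ CARD('n)) powr (1 / p))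
      \<le> sobolev_norm \<Omega> B p (abs_aefun (bump_sum a h K \<epsilon>))"
      unfolding bump_sum_sobolev(2)[OF *(1,2) assms(2) *(3,4) *(5)[rule_format]] \<beta>(2) by (simp only: mult.commute)
  qed
qed


section \<open>Type and cotype of an operator that factors through a Hilbert space\<close>

lemma sobolev_norm_nonneg:
  assumes "coherent A" shows "0 \<le> sobolev_norm \<Omega> A p u"
proof -
  obtain \<alpha> where "\<alpha> \<in> A" using assms by (auto simp: coherent_def)
  then show ?thesis unfolding sobolev_norm_def using assms
    by (intro cSUP_upper2[where x = \<alpha>]) (auto simp: coherent_def Lp_norm_def)
qed

lemma bounded_operator_signed_sum:
  assumes U: "bounded_operator E nE UNIV norm (U :: 'a::real_vector \<Rightarrow> 'h::real_normed_vector)"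
    and "finite K" and E: "\<And>J \<epsilon>. J \<subseteq> K \<Longrightarrow> (\<Sum>k\<in>J. \<epsilon> k *\<^sub>R x k) \<in> E"
  shows "U (\<Sum>k\<in>K. \<epsilon> k *\<^sub>R x k) = (\<Sum>k\<in>K. \<epsilon> k *\<^sub>R U (x k))"
  using assms(2) E
proof (induction K)
  case empty
  have "0 \<in> E" using empty[of "{}"] by simp
  then have "U (0 *\<^sub>R 0) = 0 *\<^sub>R U 0" using U unfolding bounded_operator_def by blast
  then show ?case by simp
next
  case (insert j K)
  have "x j \<in> E" "\<epsilon> j *\<^sub>R x j \<in> E"
    using insert.prems[of "{j}" "\<lambda>_. 1"] insert.prems[of "{j}" \<epsilon>] by simp_all
  moreover have "(\<Sum>k\<in>K. \<epsilon> k *\<^sub>R x k) \<in> E" by (rule insert.prems) auto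
  moreover have "U (\<Sum>k\<in>K. \<epsilon> k *\<^sub>R x k) = (\<Sum>k\<in>K. \<epsilon> k *\<^sub>R U (x k))"
    by (rule insert.IH) (rule insert.prems, auto)
  ultimately show ?case using U insert.hyps unfolding bounded_operator_def by simp
qed

text \<open>Each inequality reduces to a choice of signs in the Hilbert space, for the vectors \<open>U (x k)\<close>. The
  embedding being the identity, \<open>u = V (U u)\<close> bounds the norm in \<open>F\<close> by the Hilbert space norm of
  \<open>U u\<close>, for single elements as well as for signed sums.\<close>

lemma two_factorable_type_cotype:
  fixes E F :: "'a::real_vector set"
  assumes fact: "two_factorable TYPE('h::{real_inner,complete_space}) E nE F nF (\<lambda>u. u)"
    and nonneg: "\<And>u. 0 \<le> nE u" "\<And>u. 0 \<le> nF u"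
  shows "\<exists>C\<ge>0. (\<forall>u\<in>E. nF u \<le> C * nE u) \<and>
    (\<forall>K x. finite K \<longrightarrow> (\<forall>J \<epsilon>. J \<subseteq> K \<longrightarrow> (\<Sum>k\<in>J. \<epsilon> k *\<^sub>R x k) \<in> E) \<longrightarrow>
      (\<exists>\<epsilon>. (\<forall>k::'k. \<epsilon> k \<in> {-1, 1}) \<and> (nF (\<Sum>k\<in>K. \<epsilon> k *\<^sub>R x k))\<^sup>2 \<le> C\<^sup>2 * (\<Sum>k\<in>K. (nE (x k))\<^sup>2)) \<and>
      (\<exists>\<epsilon>. (\<forall>k::'k. \<epsilon> k \<in> {-1, 1}) \<and> (\<Sum>k\<in>K. (nF (x k))\<^sup>2) \<le> C\<^sup>2 * (nE (\<Sum>k\<in>K. \<epsilon> k *\<^sub>R x k))\<^sup>2))"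
proof -
  obtain U :: "'a \<Rightarrow> 'h" and V :: "'h \<Rightarrow> 'a" where U: "bounded_operator E nE UNIV norm U"
    and V: "bounded_operator UNIV norm F nF V" and VU: "\<forall>u\<in>E. u = V (U u)"
    using fact unfolding two_factorable_def by (elim conjE exE) (rule that)
  obtain K1 where K1: "\<forall>u\<in>E. norm (U u) \<le> K1 * nE u"
    using U unfolding bounded_operator_def by (elim conjE exE) (rule that)
  obtain K2 where K2: "\<forall>h\<in>UNIV. nF (V h) \<le> K2 * norm h"
    using V unfolding bounded_operator_def by (elim conjE exE) (rule that)
  have U_le: "norm (U u) \<le> \<bar>K1\<bar> * nE u" if "u \<in> E" for u
    using bspec[OF K1 that] mult_right_mono[OF abs_ge_self nonneg(1)] by (rule order_trans)
  have F_le: "nF u \<le> \<bar>K2\<bar> * norm (U u)" if "u \<in> E" for u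
  proof -
    have "nF u \<le> K2 * norm (U u)"
      using bspec[OF K2, of "U u"] unfolding bspec[OF VU that, symmetric] by simp
    also have "\<dots> \<le> \<bar>K2\<bar> * norm (U u)" by (intro mult_right_mono) auto
    finally show ?thesis .
  qed
  have U_le2: "(norm (U u))\<^sup>2 \<le> K1\<^sup>2 * (nE u)\<^sup>2" if "u \<in> E" for u
    using power_mono[OF U_le[OF that], of 2] by (simp add: power_mult_distrib)
  have F_le2: "(nF u)\<^sup>2 \<le> K2\<^sup>2 * (norm (U u))\<^sup>2" if "u \<in> E" for u
    using power_mono[OF F_le[OF that] nonneg(2), of 2] by (simp add: power_mult_distrib)
  have C2: "(\<bar>K2\<bar> * \<bar>K1\<bar>)\<^sup>2 = K2\<^sup>2 * K1\<^sup>2" by (simp add: power_mult_distrib)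
  show ?thesis
  proof (intro exI[of _ "\<bar>K2\<bar> * \<bar>K1\<bar>"] conjI allI impI ballI)
    fix u assume "u \<in> E"
    then show "nF u \<le> \<bar>K2\<bar> * \<bar>K1\<bar> * nE u"
      using F_le[of u] mult_left_mono[OF U_le, of u "\<bar>K2\<bar>"] by (simp add: mult.assoc)
  next
    fix K :: "'k set" and x :: "'k \<Rightarrow> 'a"
    assume K: "finite K" and "\<forall>J \<epsilon>. J \<subseteq> K \<longrightarrow> (\<Sum>k\<in>J. \<epsilon> k *\<^sub>R x k) \<in> E"
    note E = this(2)[rule_format]
    have xE: "x k \<in> E" if "k \<in> K" for k using E[of "{k}" "\<lambda>_. 1"] that by simp
    have U_sum: "U (\<Sum>k\<in>K. \<epsilon> k *\<^sub>R x k) = (\<Sum>k\<in>K. \<epsilon> k *\<^sub>R U (x k))" for \<epsilon>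
      by (rule bounded_operator_signed_sum[OF U K E])
    show "\<exists>\<epsilon>. (\<forall>k. \<epsilon> k \<in> {-1, 1}) \<and>
        (nF (\<Sum>k\<in>K. \<epsilon> k *\<^sub>R x k))\<^sup>2 \<le> (\<bar>K2\<bar> * \<bar>K1\<bar>)\<^sup>2 * (\<Sum>k\<in>K. (nE (x k))\<^sup>2)"
    proof -
      obtain \<epsilon> where \<epsilon>: "\<forall>k. \<epsilon> k \<in> {-1, 1}"
        and le: "(norm (\<Sum>k\<in>K. \<epsilon> k *\<^sub>R U (x k)))\<^sup>2 \<le> (\<Sum>k\<in>K. (norm (U (x k)))\<^sup>2)"
        using ex_signs_norm_le[OF K, of "\<lambda>k. U (x k)"] by (elim exE conjE) (rule that)
      have "(nF (\<Sum>k\<in>K. \<epsilon> k *\<^sub>R x k))\<^sup>2 \<le> K2\<^sup>2 * (norm (\<Sum>k\<in>K. \<epsilon> k *\<^sub>R U (x k)))\<^sup>2"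
        using F_le2[OF E[OF subset_refl, of \<epsilon>]] by (simp only: U_sum)
      also have "\<dots> \<le> K2\<^sup>2 * (\<Sum>k\<in>K. (norm (U (x k)))\<^sup>2)"
        by (rule mult_left_mono[OF le zero_le_power2])
      also have "\<dots> \<le> K2\<^sup>2 * (\<Sum>k\<in>K. K1\<^sup>2 * (nE (x k))\<^sup>2)"
        by (intro mult_left_mono sum_mono U_le2 xE) auto
      also have "\<dots> = (\<bar>K2\<bar> * \<bar>K1\<bar>)\<^sup>2 * (\<Sum>k\<in>K. (nE (x k))\<^sup>2)"
        unfolding C2 by (simp only: sum_distrib_left mult.assoc)
      finally show ?thesis by (intro exI[of _ \<epsilon>] conjI \<epsilon>)
    qed
    show "\<exists>\<epsilon>. (\<forall>k. \<epsilon> k \<in> {-1, 1}) \<and>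
        (\<Sum>k\<in>K. (nF (x k))\<^sup>2) \<le> (\<bar>K2\<bar> * \<bar>K1\<bar>)\<^sup>2 * (nE (\<Sum>k\<in>K. \<epsilon> k *\<^sub>R x k))\<^sup>2"
    proof -
      obtain \<epsilon> where \<epsilon>: "\<forall>k. \<epsilon> k \<in> {-1, 1}"
        and le: "(\<Sum>k\<in>K. (norm (U (x k)))\<^sup>2) \<le> (norm (\<Sum>k\<in>K. \<epsilon> k *\<^sub>R U (x k)))\<^sup>2"
        using ex_signs_norm_ge[OF K, of "\<lambda>k. U (x k)"] by (elim exE conjE) (rule that)
      have "(\<Sum>k\<in>K. (nF (x k))\<^sup>2) \<le> (\<Sum>k\<in>K. K2\<^sup>2 * (norm (U (x k)))\<^sup>2)"
        by (intro sum_mono F_le2 xE)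
      also have "\<dots> \<le> K2\<^sup>2 * (norm (\<Sum>k\<in>K. \<epsilon> k *\<^sub>R U (x k)))\<^sup>2"
        unfolding sum_distrib_left[symmetric] by (rule mult_left_mono[OF le zero_le_power2])
      also have "\<dots> \<le> K2\<^sup>2 * (K1\<^sup>2 * (nE (\<Sum>k\<in>K. \<epsilon> k *\<^sub>R x k))\<^sup>2)"
        unfolding U_sum[symmetric] by (intro mult_left_mono U_le2 E) auto
      finally show ?thesis unfolding C2 mult.assoc by (intro exI[of _ \<epsilon>] conjI \<epsilon>)
    qed
  qed simp_all
qed

section \<open>Comparison of exponents\<close>

text \<open>Otherwise \<open>m powr (a - b)\<close> would remain below \<open>C / c\<close> although it tends to infinity.\<close>

lemma powr_exponent_le:
  fixes a b c C :: real
  assumes "c > 0" and le: "\<And>m::nat. m \<ge> 1 \<Longrightarrow> c * real m powr a \<le> C * real m powr b"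
  shows "a \<le> b"
proof (rule ccontr)
  assume "\<not> a \<le> b"
  define X where "X = \<bar>C / c\<bar> + 1"
  have X: "X \<ge> 1" "X > C / c" using abs_ge_self[of "C / c"] unfolding X_def by linarith+
  obtain m :: nat where m: "real m > X powr (1 / (a - b))" using reals_Archimedean2 by blast
  have "1 \<le> X powr (1 / (a - b))" using X \<open>\<not> a \<le> b\<close> by (intro ge_one_powr_ge_zero) auto
  with m have m1: "m \<ge> 1" by linarith
  have "X = (X powr (1 / (a - b))) powr (a - b)" using X \<open>\<not> a \<le> b\<close> by (simp add: powr_powr)
  also have "\<dots> \<le> real m powr (a - b)" using m \<open>\<not> a \<le> b\<close> by (intro powr_mono2) auto
  also have "\<dots> = real m powr a / real m powr b" by (rule powr_diff)
  also have "\<dots> \<le> C / c" using le[OF m1] m1 assms(1) by (simp add: field_simps)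
  finally show False using X by simp
qed

text \<open>The two kinds of families used as tests: all \<open>m\<^sup>d\<close> cells of the grid, whose total volume is independent
  of \<open>m\<close>, and a single cell.\<close>

lemma grid_scaling:
  assumes "m \<ge> 1" "L > 0"
  shows "(1 / (L / real m)) ^ r * (real (card (grid m :: ('n::finite \<Rightarrow> nat) set)) * (L / real m) ^ CARD('n)) powr (1 / p) =
      (1 / L) ^ r * (L ^ CARD('n)) powr (1 / p) * real m powr real r"
    and "(1 / (L / real m)) ^ r * (real (card {k}) * (L / real m) ^ CARD('n)) powr (1 / p) =
      (1 / L) ^ r * (L ^ CARD('n)) powr (1 / p) * real m powr (real r - real CARD('n) / p)"
proof -
  have r: "(1 / (L / real m)) ^ r = (1 / L) ^ r * real m powr real r"
    using assms by (simp add: powr_realpow power_divide)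
  have "real (card (grid m :: ('n \<Rightarrow> nat) set)) * (L / real m) ^ CARD('n) = L ^ CARD('n)"
    using assms by (simp add: card_grid power_divide)
  with r show "(1 / (L / real m)) ^ r * (real (card (grid m :: ('n \<Rightarrow> nat) set)) * (L / real m) ^ CARD('n)) powr (1 / p) =
      (1 / L) ^ r * (L ^ CARD('n)) powr (1 / p) * real m powr real r"
    by (simp only: mult_ac)
  have "((L / real m) ^ CARD('n)) powr (1 / p) = (L ^ CARD('n)) powr (1 / p) / (real m powr real CARD('n)) powr (1 / p)"
    using assms by (simp add: power_divide powr_divide powr_realpow)
  then have "((L / real m) ^ CARD('n)) powr (1 / p) = (L ^ CARD('n)) powr (1 / p) / real m powr (real CARD('n) / p)"
    by (simp add: powr_powr)
  with r show "(1 / (L / real m)) ^ r * (real (card {k}) * (L / real m) ^ CARD('n)) powr (1 / p) =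
      (1 / L) ^ r * (L ^ CARD('n)) powr (1 / p) * real m powr (real r - real CARD('n) / p)"
    by (simp add: powr_diff)
qed

lemma open_contains_small_cube:
  fixes \<Omega> :: "(real^'n::finite) set"
  assumes "open \<Omega>" "\<Omega> \<noteq> {}"
  obtains a L where "0 < L" "L \<le> 1" "cbox a (a + (\<chi> i. L)) \<subseteq> \<Omega>"
proof -
  obtain x where "x \<in> \<Omega>" using assms(2) by blast
  then obtain a b where ab: "cbox a b \<subseteq> \<Omega>" "x \<in> box a b"
    using open_contains_cbox[OF assms(1)] by metis
  define L where "L = Min (insert 1 (range (\<lambda>i. b $ i - a $ i)))"
  have "a $ i < b $ i" for i using ab(2) unfolding mem_box_cart by (metis less_trans)
  then have "0 < L" unfolding L_def by (subst Min_gr_iff) auto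
  moreover have "L \<le> 1" unfolding L_def by (intro Min_le) auto
  moreover have "L \<le> b $ i - a $ i" for i unfolding L_def by (intro Min_le) auto
  then have le: "a $ i + L \<le> b $ i" for i by (simp add: algebra_simps)
  have "cbox a (a + (\<chi> i. L)) \<subseteq> cbox a b"
    by (auto simp: mem_box_cart) (metis le order_trans)
  ultimately show ?thesis using ab(1) that by blast
qed

theorem theorem14:
  fixes \<Omega> :: "(real^'n::finite) set"
    and A B :: "('n \<Rightarrow> nat) set"
    and p1 p2 d s t :: real
  assumes "bounded_domain \<Omega>"
    and "coherent A" and "coherent B"
    and "1 \<le> p1" and "1 \<le> p2"
    and "embedding_exists (sobolev_space \<Omega> A p1) (sobolev_norm \<Omega> A p1)
           (sobolev_space \<Omega> B p2) (sobolev_norm \<Omega> B p2)"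
    and "d = real CARD('n)" and "s = real (set_order A)" and "t = real (set_order B)"
    and "s - t \<ge> d * (1 / p1 - 1 / p2)"
    and "two_factorable TYPE('h::{real_inner,complete_space})
           (sobolev_space \<Omega> A p1) (sobolev_norm \<Omega> A p1)
           (sobolev_space \<Omega> B p2) (sobolev_norm \<Omega> B p2) (\<lambda>u. u)"
  shows "s - t \<ge> max 0 (d / p1 - d / 2) + max 0 (d / 2 - d / p2)"
proof -
  let ?E = "sobolev_space \<Omega> A p1" and ?nE = "sobolev_norm \<Omega> A p1" and ?nF = "sobolev_norm \<Omega> B p2"
  have p: "p1 > 0" "p2 > 0" using assms(4,5) by auto
  have \<Omega>: "open \<Omega>" "\<Omega> \<noteq> {}" using assms(1) by (auto simp: bounded_domain_def)
  obtain a L where L: "0 < L" "L \<le> 1" "cbox a (a + (\<chi> i. L)) \<subseteq> \<Omega>"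
    by (rule open_contains_small_cube[OF \<Omega>], rule that)
  define u where "u = (\<lambda>m k. abs_aefun (bump_sum a (L / real m) {k} (\<lambda>_. 1)))"
  define v where "v = (\<lambda>m \<epsilon>. abs_aefun (bump_sum a (L / real m) (grid m) \<epsilon>))"
  have h: "0 < L / real m" "L / real m \<le> 1" "cbox a (a + (\<chi> i. real m * (L / real m))) \<subseteq> \<Omega>" if "m \<ge> 1" for m
    using L that by (auto simp: field_simps intro: order_trans)
  have abs_sign: "\<bar>\<epsilon> k\<bar> = 1" if "\<forall>k::'n \<Rightarrow> nat. \<epsilon> k \<in> {-1, 1::real}" for \<epsilon> k
    using that by (metis abs_1 abs_minus_cancel insertE singletonD)

  obtain CE where CE: "CE > 0"
    and v_le: "\<And>m \<epsilon>. m \<ge> 1 \<Longrightarrow> \<forall>k. \<epsilon> k \<in> {-1, 1} \<Longrightarrow> ?nE (v m \<epsilon>) \<le> CE * real m powr s"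
    and u_le: "\<And>m k. m \<ge> 1 \<Longrightarrow> k \<in> grid m \<Longrightarrow> ?nE (u m k) \<le> CE * real m powr (s - d / p1)"
  proof -
    obtain C where C: "C > 0" and le: "\<forall>\<Omega> h m K a \<epsilon>. open \<Omega> \<longrightarrow> 0 < h \<longrightarrow> h \<le> 1 \<longrightarrow> K \<subseteq> grid m \<longrightarrow>
      cbox a (a + (\<chi> i. real m * h)) \<subseteq> \<Omega> \<longrightarrow> (\<forall>k. \<bar>\<epsilon> k\<bar> = 1) \<longrightarrow>
      sobolev_norm \<Omega> A p1 (abs_aefun (bump_sum a h K \<epsilon>)) \<le>
        C * ((1 / h) ^ set_order A * (real (card K) * h ^ CARD('n)) powr (1 / p1))"
      using sobolev_norm_bump_sum_le[OF assms(2) p(1)] by (elim exE conjE) (rule that)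
    note le = le[rule_format]
    show ?thesis
    proof (rule that[of "C * ((1 / L) ^ set_order A * (L ^ CARD('n)) powr (1 / p1))"])
      show "C * ((1 / L) ^ set_order A * (L ^ CARD('n)) powr (1 / p1)) > 0" using C L by simp
      show "?nE (v m \<epsilon>) \<le> C * ((1 / L) ^ set_order A * (L ^ CARD('n)) powr (1 / p1)) * real m powr s"
        if m: "m \<ge> 1" and \<epsilon>: "\<forall>k. \<epsilon> k \<in> {-1, 1}" for m \<epsilon>
        using le[OF \<Omega>(1) h(1,2)[OF m] subset_refl h(3)[OF m] abs_sign[OF \<epsilon>]]
        unfolding v_def assms(8) grid_scaling(1)[OF m L(1)] by (simp only: mult.assoc)
      show "?nE (u m k) \<le> C * ((1 / L) ^ set_order A * (L ^ CARD('n)) powr (1 / p1)) * real m powr (s - d / p1)"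
        if m: "m \<ge> 1" and k: "k \<in> grid m" for m k
        using le[OF \<Omega>(1) h(1,2)[OF m] _ h(3)[OF m], of "{k}" "\<lambda>_. 1"] k
        unfolding u_def assms(7,8) grid_scaling(2)[OF m L(1)] by (simp add: mult.assoc)
    qed
  qed
  obtain cF where cF: "cF > 0"
    and v_ge: "\<And>m \<epsilon>. m \<ge> 1 \<Longrightarrow> \<forall>k. \<epsilon> k \<in> {-1, 1} \<Longrightarrow> cF * real m powr t \<le> ?nF (v m \<epsilon>)"
    and u_ge: "\<And>m k. m \<ge> 1 \<Longrightarrow> k \<in> grid m \<Longrightarrow> cF * real m powr (t - d / p2) \<le> ?nF (u m k)"
  proof -
    obtain c where c: "c > 0" and ge: "\<forall>\<Omega> h m K a \<epsilon>. open \<Omega> \<longrightarrow> 0 < h \<longrightarrow> K \<subseteq> grid m \<longrightarrow>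
      cbox a (a + (\<chi> i. real m * h)) \<subseteq> \<Omega> \<longrightarrow> (\<forall>k. \<bar>\<epsilon> k\<bar> = 1) \<longrightarrow>
      c * ((1 / h) ^ set_order B * (real (card K) * h ^ CARD('n)) powr (1 / p2))
      \<le> sobolev_norm \<Omega> B p2 (abs_aefun (bump_sum a h K \<epsilon>))"
      using sobolev_norm_bump_sum_ge[OF assms(3) p(2)] by (elim exE conjE) (rule that)
    note ge = ge[rule_format]
    show ?thesis
    proof (rule that[of "c * ((1 / L) ^ set_order B * (L ^ CARD('n)) powr (1 / p2))"])
      show "c * ((1 / L) ^ set_order B * (L ^ CARD('n)) powr (1 / p2)) > 0" using c L by simp
      show "c * ((1 / L) ^ set_order B * (L ^ CARD('n)) powr (1 / p2)) * real m powr t \<le> ?nF (v m \<epsilon>)"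
        if m: "m \<ge> 1" and \<epsilon>: "\<forall>k. \<epsilon> k \<in> {-1, 1}" for m \<epsilon>
        using ge[OF \<Omega>(1) h(1)[OF m] subset_refl h(3)[OF m] abs_sign[OF \<epsilon>]]
        unfolding v_def assms(9) grid_scaling(1)[OF m L(1)] by (simp only: mult.assoc)
      show "c * ((1 / L) ^ set_order B * (L ^ CARD('n)) powr (1 / p2)) * real m powr (t - d / p2) \<le> ?nF (u m k)"
        if m: "m \<ge> 1" and k: "k \<in> grid m" for m k
        using ge[OF \<Omega>(1) h(1)[OF m] _ h(3)[OF m], of "{k}" "\<lambda>_. 1"] k
        unfolding u_def assms(7,9) grid_scaling(2)[OF m L(1)] by (simp add: mult.assoc)
    qed
  qed

  obtain C where C: "C \<ge> 0" and emb: "\<forall>u\<in>?E. ?nF u \<le> C * ?nE u"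
    and signs: "\<forall>K x. finite K \<longrightarrow> (\<forall>J \<epsilon>. J \<subseteq> K \<longrightarrow> (\<Sum>k\<in>J. \<epsilon> k *\<^sub>R x k) \<in> ?E) \<longrightarrow>
       (\<exists>\<epsilon>. (\<forall>k::'n \<Rightarrow> nat. \<epsilon> k \<in> {-1, 1}) \<and> (?nF (\<Sum>k\<in>K. \<epsilon> k *\<^sub>R x k))\<^sup>2 \<le> C\<^sup>2 * (\<Sum>k\<in>K. (?nE (x k))\<^sup>2)) \<and>
       (\<exists>\<epsilon>. (\<forall>k::'n \<Rightarrow> nat. \<epsilon> k \<in> {-1, 1}) \<and> (\<Sum>k\<in>K. (?nF (x k))\<^sup>2) \<le> C\<^sup>2 * (?nE (\<Sum>k\<in>K. \<epsilon> k *\<^sub>R x k))\<^sup>2)"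
    using two_factorable_type_cotype[OF assms(11) sobolev_norm_nonneg[OF assms(2)] sobolev_norm_nonneg[OF assms(3)]]
    by (elim exE conjE) (rule that)
  have in_E: "abs_aefun (bump_sum a (L / real m) J \<epsilon>) \<in> ?E" if "m \<ge> 1" "J \<subseteq> grid m" for m J \<epsilon>
    by (rule bump_sum_sobolev(1)[OF \<Omega>(1) h(1)[OF that(1)] p(1) that(2) h(3)[OF that(1)]])
  have sum_eq: "(\<Sum>k\<in>J. \<epsilon> k *\<^sub>R u m k) = abs_aefun (bump_sum a (L / real m) J \<epsilon>)" if "J \<subseteq> grid m" for m J \<epsilon>
    unfolding u_def by (rule abs_aefun_bump_sum[symmetric]) (rule finite_subset[OF that finite_grid])
  have signed_sums: "\<forall>J \<epsilon>. J \<subseteq> grid m \<longrightarrow> (\<Sum>k\<in>J. \<epsilon> k *\<^sub>R u m k) \<in> ?E" if "m \<ge> 1" for m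
    using in_E[OF that] sum_eq by simp
  note signs = signs[THEN spec, THEN spec, THEN mp, THEN mp, OF finite_grid signed_sums]
  have card: "real (card (grid m :: ('n \<Rightarrow> nat) set)) = real m powr d" if "m \<ge> 1" for m
    using that by (simp add: card_grid assms(7) powr_realpow)
  have square: "(c * real m powr e)\<^sup>2 = c\<^sup>2 * real m powr (2 * e)" for c m e
    by (simp add: power_mult_distrib power2_eq_square flip: powr_add)

  \<comment> \<open>boundedness of the embedding, tested on all bumps together\<close>
  have "t \<le> s"
  proof (rule powr_exponent_le[OF cF])
    fix m :: nat assume m: "m \<ge> 1"
    have "cF * real m powr t \<le> ?nF (v m (\<lambda>_. 1))" by (rule v_ge[OF m]) simp
    also have "\<dots> \<le> C * ?nE (v m (\<lambda>_. 1))" unfolding v_def by (rule bspec[OF emb in_E[OF m subset_refl]])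
    also have "\<dots> \<le> C * (CE * real m powr s)" by (intro mult_left_mono v_le[OF m] C) simp
    finally show "cF * real m powr t \<le> C * CE * real m powr s" by (simp add: mult.assoc)
  qed
  \<comment> \<open>type 2: the signed sum in the target against the single bumps in the source\<close>
  moreover have "2 * t \<le> d + 2 * (s - d / p1)"
  proof (rule powr_exponent_le[of "cF\<^sup>2"])
    fix m :: nat assume m: "m \<ge> 1"
    obtain \<epsilon> where \<epsilon>: "\<forall>k. \<epsilon> k \<in> {-1, 1}"
      and le: "(?nF (\<Sum>k\<in>grid m. \<epsilon> k *\<^sub>R u m k))\<^sup>2 \<le> C\<^sup>2 * (\<Sum>k\<in>grid m. (?nE (u m k))\<^sup>2)"
      using conjunct1[OF signs[OF m]] by (elim exE conjE) (rule that)
    have "(cF * real m powr t)\<^sup>2 \<le> (?nF (v m \<epsilon>))\<^sup>2"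
      using cF by (intro power_mono v_ge[OF m \<epsilon>]) simp
    also have "\<dots> \<le> C\<^sup>2 * (\<Sum>k\<in>grid m. (?nE (u m k))\<^sup>2)"
      using le unfolding sum_eq[OF subset_refl] v_def .
    also have "\<dots> \<le> C\<^sup>2 * (\<Sum>k\<in>(grid m :: ('n \<Rightarrow> nat) set). (CE * real m powr (s - d / p1))\<^sup>2)"
      by (rule mult_left_mono[OF sum_mono[OF power_mono[OF u_le[OF m] sobolev_norm_nonneg[OF assms(2)]]] zero_le_power2])
    also have "\<dots> = C\<^sup>2 * CE\<^sup>2 * real m powr (d + 2 * (s - d / p1))"
      by (simp add: card[OF m] square powr_add)
    finally show "cF\<^sup>2 * real m powr (2 * t) \<le> C\<^sup>2 * CE\<^sup>2 * real m powr (d + 2 * (s - d / p1))"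
      unfolding square .
  qed (use cF in simp)
  \<comment> \<open>cotype 2: the single bumps in the target against the signed sum in the source\<close>
  moreover have "d + 2 * (t - d / p2) \<le> 2 * s"
  proof (rule powr_exponent_le[of "cF\<^sup>2"])
    fix m :: nat assume m: "m \<ge> 1"
    obtain \<epsilon> where \<epsilon>: "\<forall>k. \<epsilon> k \<in> {-1, 1}"
      and le: "(\<Sum>k\<in>grid m. (?nF (u m k))\<^sup>2) \<le> C\<^sup>2 * (?nE (\<Sum>k\<in>grid m. \<epsilon> k *\<^sub>R u m k))\<^sup>2"
      using conjunct2[OF signs[OF m]] by (elim exE conjE) (rule that)
    have "cF\<^sup>2 * real m powr (d + 2 * (t - d / p2)) = (\<Sum>k\<in>(grid m :: ('n \<Rightarrow> nat) set). (cF * real m powr (t - d / p2))\<^sup>2)"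
      by (simp add: card[OF m] square powr_add)
    also have "\<dots> \<le> (\<Sum>k\<in>grid m. (?nF (u m k))\<^sup>2)"
      using cF by (intro sum_mono power_mono u_ge[OF m]) simp_all
    also have "\<dots> \<le> C\<^sup>2 * (?nE (v m \<epsilon>))\<^sup>2"
      using le unfolding sum_eq[OF subset_refl] v_def .
    also have "\<dots> \<le> C\<^sup>2 * (CE * real m powr s)\<^sup>2"
      by (intro mult_left_mono power_mono v_le[OF m \<epsilon>] sobolev_norm_nonneg[OF assms(2)] zero_le_power2)
    finally show "cF\<^sup>2 * real m powr (d + 2 * (t - d / p2)) \<le> C\<^sup>2 * CE\<^sup>2 * real m powr (2 * s)"
      unfolding square by (simp only: mult.assoc)
  qed (use cF in simp)
  moreover have "s - t \<ge> d / p1 - d / p2" using assms(10) by (simp add: right_diff_distrib)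
  ultimately show ?thesis by (auto simp: max_def)
qed

end
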